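(* Let $D$ be a continuous dcpo with a basis $B$. (i) If $D$ is pointed (with least element $\perp$) and for every $b\in B$ it is decidable whether $b=\perp$, then $\perp$ is sharp. (ii) If for all $a,b\in B$ it is decidable whether $a\ll b$, or if for all $a,b\in B$ it is decidable whether $a\sqsubseteq b$, then every element of $B$ is sharp. In particular, in these cases the set of sharp elements is Scott dense in $D$: its Scott closure is all of $D$, and every inhabited Scott open subset of $D$ contains a sharp element. If moreover $D$ is algebraic, then for its set $K$ of compact elements: (iii) if $D$ is pointed, then $\perp$ is sharp if and only if for every $c\in K$ it is decidable whether $c=\perp$; (iv) every compact element of $D$ is sharp if and only if ($a\ll b$ is decidable for all $a,b\in K$) or ($a\sqsubseteq b$ is decidable for all $a,b\in K$).
   Context: We work constructively: informal set theory without excluded middle or choice. A dcpo is a poset in which every directed subset (inhabited, any two elements have an upper bound in it) has a supremum; it is pointed if it has a least element $\perp$. $x\ll y$ if for every directed $S$ with $y\sqsubseteq\bigsqcup S$ some $s\in S$ has $x\sqsubseteq s$. A basis is a subset $B$ such that for each $x$, $\{b\in B\mid b\ll x\}$ is directed with supremum $x$; $D$ is continuous if it has a basis. An element $c$ is compact if $c\ll c$; $D$ is algebraic if for every $x$ the set of compact $c\sqsubseteq x$ is directed with supremum $x$. A subset is Scott open if it is an upper set inaccessible by directed suprema, and Scott closed if it is a lower set closed under directed suprema; the Scott closure of a set is the least Scott closed set containing it. An element $x\in D$ is sharp if for all $y,z\in D$ with $y\ll z$ we have $y\ll x$ or $\neg(z\sqsubseteq x)$. A proposition $P$ is decidable if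 $P\vee\neg P$. *)

theory Defs
  imports Main
begin

text \<open>
  HOL is classical, so stated directly in HOL every decidability hypothesis below would be a
  tautology and every element of every dcpo would be sharp.  The theorem is therefore stated as
  derivability in intuitionistic second-order logic over one sort \<open>D\<close> of elements, with
  a binary relation symbol \<open>\<sqsubseteq>\<close>, equality, variables for subsets of \<open>D\<close>
  and full comprehension.  Nothing is assumed of \<open>\<sqsubseteq>\<close>, and there is neither
  excluded middle nor choice.
\<close>

section \<open>Intuitionistic second-order logic\<close>

text \<open>
  De Bruijn indices, counted separately for element variables and for subset variables.
  All terms are variables, so substitution is renaming.
\<close>

datatype form =
    Le nat nat
  | Eq nat nat
  | Mem nat nat  \<comment> \<open>element index, subset index\<close>
  | Falsity
  | Conj form form
  | Disj form form
  | Impl form form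
  | Forall form
  | Exists form
  | Forall2 form
  | Exists2 form

definition scons :: "nat \<Rightarrow> (nat \<Rightarrow> nat) \<Rightarrow> nat \<Rightarrow> nat" where
  "scons t f = case_nat t f"

primrec ren :: "(nat \<Rightarrow> nat) \<Rightarrow> (nat \<Rightarrow> nat) \<Rightarrow> form \<Rightarrow> form" where
  "ren f g (Le i j) = Le (f i) (f j)"
| "ren f g (Eq i j) = Eq (f i) (f j)"
| "ren f g (Mem i k) = Mem (f i) (g k)"
| "ren f g Falsity = Falsity"
| "ren f g (Conj p q) = Conj (ren f g p) (ren f g q)"
| "ren f g (Disj p q) = Disj (ren f g p) (ren f g q)"
| "ren f g (Impl p q) = Impl (ren f g p) (ren f g q)"
| "ren f g (Forall p) = Forall (ren (scons 0 (Suc \<circ> f)) g p)"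
| "ren f g (Exists p) = Exists (ren (scons 0 (Suc \<circ> f)) g p)"
| "ren f g (Forall2 p) = Forall2 (ren f (scons 0 (Suc \<circ> g)) p)"
| "ren f g (Exists2 p) = Exists2 (ren f (scons 0 (Suc \<circ> g)) p)"

abbreviation lift :: "form \<Rightarrow> form" where "lift \<equiv> ren Suc id"
abbreviation lift2 :: "form \<Rightarrow> form" where "lift2 \<equiv> ren id Suc"
abbreviation inst :: "nat \<Rightarrow> form \<Rightarrow> form" where "inst t \<equiv> ren (scons t id) id"
abbreviation inst2 :: "nat \<Rightarrow> form \<Rightarrow> form" where "inst2 s \<equiv> ren id (scons s id)"

text \<open>
  Natural deduction.  In \<open>derives n G p\<close> the element variables in scope are those
  with index below \<open>n\<close>, and only these may be used as witnesses or instances, so that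
  \<open>D\<close> is not presupposed to be inhabited.  Subset variables need no such bound:
  every \<open>D\<close> has a subset.
\<close>

inductive derives :: "nat \<Rightarrow> form list \<Rightarrow> form \<Rightarrow> bool" where
  assm: "p \<in> set G \<Longrightarrow> derives n G p"
| FalsityE: "derives n G Falsity \<Longrightarrow> derives n G p"
| ConjI: "derives n G p \<Longrightarrow> derives n G q \<Longrightarrow> derives n G (Conj p q)"
| ConjE1: "derives n G (Conj p q) \<Longrightarrow> derives n G p"
| ConjE2: "derives n G (Conj p q) \<Longrightarrow> derives n G q"
| DisjI1: "derives n G p \<Longrightarrow> derives n G (Disj p q)"
| DisjI2: "derives n G q \<Longrightarrow> derives n G (Disj p q)"
| DisjE: "derives n G (Disj p q) \<Longrightarrow> derives n (p # G) r \<Longrightarrow> derives n (q # G) r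
    \<Longrightarrow> derives n G r"
| ImplI: "derives n (p # G) q \<Longrightarrow> derives n G (Impl p q)"
| ImplE: "derives n G (Impl p q) \<Longrightarrow> derives n G p \<Longrightarrow> derives n G q"
| AllI: "derives (Suc n) (map lift G) p \<Longrightarrow> derives n G (Forall p)"
| AllE: "derives n G (Forall p) \<Longrightarrow> t < n \<Longrightarrow> derives n G (inst t p)"
| ExI: "derives n G (inst t p) \<Longrightarrow> t < n \<Longrightarrow> derives n G (Exists p)"
| ExE: "derives n G (Exists p) \<Longrightarrow> derives (Suc n) (p # map lift G) (lift q) \<Longrightarrow> derives n G q"
| All2I: "derives n (map lift2 G) p \<Longrightarrow> derives n G (Forall2 p)"
| All2E: "derives n G (Forall2 p) \<Longrightarrow> derives n G (inst2 s p)"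
| Ex2I: "derives n G (inst2 s p) \<Longrightarrow> derives n G (Exists2 p)"
| Ex2E: "derives n G (Exists2 p) \<Longrightarrow> derives n (p # map lift2 G) (lift2 q) \<Longrightarrow> derives n G q"
| EqRefl: "t < n \<Longrightarrow> derives n G (Eq t t)"
| EqSubst: "derives n G (Eq s t) \<Longrightarrow> derives n G (inst s p) \<Longrightarrow> derives n G (inst t p)"
| Compr:  \<comment> \<open>\<open>{x | p x}\<close> exists; \<open>lift2\<close> keeps its name out of \<open>p\<close>\<close>
    "derives n G (Exists2 (Forall (Conj (Impl (Mem 0 0) (lift2 p)) (Impl (lift2 p) (Mem 0 0)))))"

section \<open>Formulas with HOL binders\<close>

text \<open>
  A \<open>prp\<close> is a formula awaiting the numbers of element and subset variables already
  bound around it.  Variables are de Bruijn levels (numbered from the outermost binder), which a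
  binder can hand to its body as an argument; they become indices at the atoms.
\<close>

type_synonym prp = "nat \<Rightarrow> nat \<Rightarrow> form"

datatype elt = Elt nat
datatype sub = Sub nat

primrec eidx :: "nat \<Rightarrow> elt \<Rightarrow> nat" where "eidx d (Elt l) = d - Suc l"
primrec sidx :: "nat \<Rightarrow> sub \<Rightarrow> nat" where "sidx e (Sub l) = e - Suc l"

definition le_p :: "elt \<Rightarrow> elt \<Rightarrow> prp" (infix "\<^bold>\<sqsubseteq>" 50) where
  "(x \<^bold>\<sqsubseteq> y) = (\<lambda>d e. Le (eidx d x) (eidx d y))"
definition eq_p :: "elt \<Rightarrow> elt \<Rightarrow> prp" (infix "\<^bold>=" 50) where
  "(x \<^bold>= y) = (\<lambda>d e. Eq (eidx d x) (eidx d y))"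
definition mem_p :: "elt \<Rightarrow> sub \<Rightarrow> prp" (infix "\<^bold>\<in>" 50) where
  "(x \<^bold>\<in> S) = (\<lambda>d e. Mem (eidx d x) (sidx e S))"
definition conj_p :: "prp \<Rightarrow> prp \<Rightarrow> prp" (infixr "\<^bold>\<and>" 35) where
  "(p \<^bold>\<and> q) = (\<lambda>d e. Conj (p d e) (q d e))"
definition disj_p :: "prp \<Rightarrow> prp \<Rightarrow> prp" (infixr "\<^bold>\<or>" 30) where
  "(p \<^bold>\<or> q) = (\<lambda>d e. Disj (p d e) (q d e))"
definition imp_p :: "prp \<Rightarrow> prp \<Rightarrow> prp" (infixr "\<^bold>\<longrightarrow>" 25) where
  "(p \<^bold>\<longrightarrow> q) = (\<lambda>d e. Impl (p d e) (q d e))"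
definition not_p :: "prp \<Rightarrow> prp" ("\<^bold>\<not> _" [40] 40) where
  "(\<^bold>\<not> p) = (\<lambda>d e. Impl (p d e) Falsity)"
definition all_p :: "(elt \<Rightarrow> prp) \<Rightarrow> prp" (binder "\<^bold>\<forall>" 10) where
  "all_p P = (\<lambda>d e. Forall (P (Elt d) (Suc d) e))"
definition ex_p :: "(elt \<Rightarrow> prp) \<Rightarrow> prp" (binder "\<^bold>\<exists>" 10) where
  "ex_p P = (\<lambda>d e. Exists (P (Elt d) (Suc d) e))"
definition all2_p :: "(sub \<Rightarrow> prp) \<Rightarrow> prp" (binder "\<^bold>\<forall>\<^sub>2" 10) where
  "all2_p P = (\<lambda>d e. Forall2 (P (Sub e) d (Suc e)))"
definition ex2_p :: "(sub \<Rightarrow> prp) \<Rightarrow> prp" (binder "\<^bold>\<exists>\<^sub>2" 10) where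
  "ex2_p P = (\<lambda>d e. Exists2 (P (Sub e) d (Suc e)))"

abbreviation iff_p :: "prp \<Rightarrow> prp \<Rightarrow> prp" (infixr "\<^bold>\<longleftrightarrow>" 25) where
  "p \<^bold>\<longleftrightarrow> q \<equiv> (p \<^bold>\<longrightarrow> q) \<^bold>\<and> (q \<^bold>\<longrightarrow> p)"

definition provable :: "prp \<Rightarrow> bool" ("\<turnstile> _" [5] 5) where
  "(\<turnstile> p) \<longleftrightarrow> derives 0 [] (p 0 0)"

definition decidable :: "prp \<Rightarrow> prp" where
  "decidable p = (p \<^bold>\<or> \<^bold>\<not> p)"

section \<open>Domain theory\<close>

text \<open>
  Subsets of \<open>D\<close> given by a defining property are class abstracts
  \<open>elt \<Rightarrow> prp\<close>; \<open>cls S\<close> is the class of members of a subset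
  variable.  Quantification is over subset variables only.
\<close>

abbreviation (input) cls :: "sub \<Rightarrow> elt \<Rightarrow> prp" where "cls S \<equiv> \<lambda>x. x \<^bold>\<in> S"

definition included :: "(elt \<Rightarrow> prp) \<Rightarrow> (elt \<Rightarrow> prp) \<Rightarrow> prp" (infix "\<^bold>\<subseteq>" 50) where
  "(A \<^bold>\<subseteq> C) = (\<^bold>\<forall>x. A x \<^bold>\<longrightarrow> C x)"

definition poset :: prp where
  "poset = ((\<^bold>\<forall>x. x \<^bold>\<sqsubseteq> x)
    \<^bold>\<and> (\<^bold>\<forall>x. \<^bold>\<forall>y. \<^bold>\<forall>z. x \<^bold>\<sqsubseteq> y \<^bold>\<longrightarrow> y \<^bold>\<sqsubseteq> z \<^bold>\<longrightarrow> x \<^bold>\<sqsubseteq> z)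
    \<^bold>\<and> (\<^bold>\<forall>x. \<^bold>\<forall>y. x \<^bold>\<sqsubseteq> y \<^bold>\<longrightarrow> y \<^bold>\<sqsubseteq> x \<^bold>\<longrightarrow> x \<^bold>= y))"

definition inhabited :: "(elt \<Rightarrow> prp) \<Rightarrow> prp" where
  "inhabited A = (\<^bold>\<exists>x. A x)"

definition directed :: "(elt \<Rightarrow> prp) \<Rightarrow> prp" where
  "directed A = (inhabited A
    \<^bold>\<and> (\<^bold>\<forall>x. \<^bold>\<forall>y. A x \<^bold>\<longrightarrow> A y \<^bold>\<longrightarrow> (\<^bold>\<exists>z. A z \<^bold>\<and> x \<^bold>\<sqsubseteq> z \<^bold>\<and> y \<^bold>\<sqsubseteq> z)))"

definition is_sup :: "elt \<Rightarrow> (elt \<Rightarrow> prp) \<Rightarrow> prp" where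
  "is_sup u A = ((\<^bold>\<forall>x. A x \<^bold>\<longrightarrow> x \<^bold>\<sqsubseteq> u)
    \<^bold>\<and> (\<^bold>\<forall>v. (\<^bold>\<forall>x. A x \<^bold>\<longrightarrow> x \<^bold>\<sqsubseteq> v) \<^bold>\<longrightarrow> u \<^bold>\<sqsubseteq> v))"

definition dcpo :: prp where
  "dcpo = (poset \<^bold>\<and> (\<^bold>\<forall>\<^sub>2S. directed (cls S) \<^bold>\<longrightarrow> (\<^bold>\<exists>u. is_sup u (cls S))))"

definition is_bottom :: "elt \<Rightarrow> prp" where
  "is_bottom p = (\<^bold>\<forall>x. p \<^bold>\<sqsubseteq> x)"

definition way_below :: "elt \<Rightarrow> elt \<Rightarrow> prp" (infix "\<^bold>\<lless>" 50) where
  "(x \<^bold>\<lless> y) = (\<^bold>\<forall>\<^sub>2S. directed (cls S) \<^bold>\<longrightarrow>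
    (\<^bold>\<forall>u. is_sup u (cls S) \<^bold>\<longrightarrow> y \<^bold>\<sqsubseteq> u \<^bold>\<longrightarrow> (\<^bold>\<exists>s. s \<^bold>\<in> S \<^bold>\<and> x \<^bold>\<sqsubseteq> s)))"

definition basis :: "(elt \<Rightarrow> prp) \<Rightarrow> prp" where
  "basis B = (\<^bold>\<forall>x. directed (\<lambda>b. B b \<^bold>\<and> b \<^bold>\<lless> x) \<^bold>\<and> is_sup x (\<lambda>b. B b \<^bold>\<and> b \<^bold>\<lless> x))"

definition continuous :: prp where
  "continuous = (\<^bold>\<exists>\<^sub>2B. basis (cls B))"

definition compact :: "elt \<Rightarrow> prp" where
  "compact c = (c \<^bold>\<lless> c)"

definition algebraic :: prp where
  "algebraic = (\<^bold>\<forall>x. directed (\<lambda>c. compact c \<^bold>\<and> c \<^bold>\<sqsubseteq> x)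
    \<^bold>\<and> is_sup x (\<lambda>c. compact c \<^bold>\<and> c \<^bold>\<sqsubseteq> x))"

definition scott_open :: "(elt \<Rightarrow> prp) \<Rightarrow> prp" where
  "scott_open U = ((\<^bold>\<forall>x. \<^bold>\<forall>y. U x \<^bold>\<longrightarrow> x \<^bold>\<sqsubseteq> y \<^bold>\<longrightarrow> U y)
    \<^bold>\<and> (\<^bold>\<forall>\<^sub>2S. directed (cls S) \<^bold>\<longrightarrow>
        (\<^bold>\<forall>u. is_sup u (cls S) \<^bold>\<longrightarrow> U u \<^bold>\<longrightarrow> (\<^bold>\<exists>s. s \<^bold>\<in> S \<^bold>\<and> U s))))"

definition scott_closed :: "(elt \<Rightarrow> prp) \<Rightarrow> prp" where
  "scott_closed C = ((\<^bold>\<forall>x. \<^bold>\<forall>y. C y \<^bold>\<longrightarrow> x \<^bold>\<sqsubseteq> y \<^bold>\<longrightarrow> C x)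
    \<^bold>\<and> (\<^bold>\<forall>\<^sub>2S. directed (cls S) \<^bold>\<longrightarrow> cls S \<^bold>\<subseteq> C \<^bold>\<longrightarrow>
        (\<^bold>\<forall>u. is_sup u (cls S) \<^bold>\<longrightarrow> C u)))"

definition is_scott_closure :: "(elt \<Rightarrow> prp) \<Rightarrow> (elt \<Rightarrow> prp) \<Rightarrow> prp" where
  "is_scott_closure C A = (scott_closed C \<^bold>\<and> A \<^bold>\<subseteq> C
    \<^bold>\<and> (\<^bold>\<forall>\<^sub>2C'. scott_closed (cls C') \<^bold>\<longrightarrow> A \<^bold>\<subseteq> cls C' \<^bold>\<longrightarrow> C \<^bold>\<subseteq> cls C'))"

definition sharp :: "elt \<Rightarrow> prp" where
  "sharp x = (\<^bold>\<forall>y. \<^bold>\<forall>z. y \<^bold>\<lless> z \<^bold>\<longrightarrow> (y \<^bold>\<lless> x \<^bold>\<or> \<^bold>\<not> (z \<^bold>\<sqsubseteq> x)))"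

end

theory Submission
  imports Defs
begin

text \<open>
  Derivability itself serves as a Kripke model.  A world is a number of element and subset variables
  in scope together with a list of hypotheses, and a formula is forced at a world when it is derivable
  there.  Because formulas are built with de Bruijn levels, a formula in scope at a world keeps its
  name in every extension, forcing is monotone, and the natural deduction rules become the usual
  forcing clauses, except that \<open>\<^bold>\<or>\<close> and \<open>\<^bold>\<exists>\<close>
  are eliminated only into forcing statements.  Binders take HOL functions, so instantiation is sound
  only for bodies that commute with renaming; this is a logical relation on renamings.

  For the mathematics: in a poset with basis \<open>A\<close>, the set of \<open>b\<close> in
  \<open>A\<close> with \<open>b \<lless> c \<lless> z\<close> for some \<open>c\<close> in
  \<open>A\<close> is directed with supremum \<open>z\<close>, so \<open>y \<lless> z\<close> interpolates as
  \<open>y \<lless> b \<lless> z\<close>.  Sharpness of \<open>x\<close> then follows by deciding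
  \<open>b \<lless> x\<close> or \<open>b \<sqsubseteq> x\<close> (or \<open>b = x\<close> if \<open>x\<close> is least):
  the positive case gives \<open>y \<lless> x\<close>, and \<open>z \<sqsubseteq> x\<close> would force the positive
  case.  In the algebraic case the compact elements form a basis, and conversely sharpness of
  \<open>x\<close> applied to \<open>c \<lless> c\<close> decides \<open>c \<lless> x\<close>.
\<close>

section \<open>Renaming of derivations\<close>

lemma scons_simps [simp]: "scons t f 0 = t" "scons t f (Suc i) = f i"
  by (simp_all add: scons_def)

lemma scons_comp_id [simp]: "scons 0 (Suc \<circ> (\<lambda>i. i)) = (\<lambda>i. i)"
  by (auto simp: fun_eq_iff scons_def split: nat.split)

lemma comp_scons: "f \<circ> scons t h = scons (f t) (f \<circ> h)"
  by (auto simp: fun_eq_iff scons_def split: nat.split)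

lemma scons_Suc_comp: "scons t f \<circ> (Suc \<circ> h) = f \<circ> h"
  by (auto simp: fun_eq_iff)

lemma ren_ren: "ren f g (ren f' g' p) = ren (f \<circ> f') (g \<circ> g') p"
  by (induction p arbitrary: f g f' g') (simp_all add: comp_scons scons_Suc_comp comp_assoc)

lemma ren_id [simp]: "ren id id p = p"
  by (induction p) (simp_all add: id_def)

lemma derives_weaken:
  assumes "derives n G p" "set G \<subseteq> set G'"
  shows "derives n G' p"
  using assms
proof (induction arbitrary: G' rule: derives.induct)
  case (DisjE n G p q r)
  have "set (p # G) \<subseteq> set (p # G')" "set (q # G) \<subseteq> set (q # G')" using DisjE.prems by auto
  with DisjE show ?case by (blast intro: derives.DisjE)
next
  case (ImplI n p G q)
  have "set (p # G) \<subseteq> set (p # G')" using ImplI.prems by auto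
  with ImplI.IH show ?case by (blast intro: derives.ImplI)
next
  case (AllI n G p)
  have "set (map lift G) \<subseteq> set (map lift G')" using AllI.prems by auto
  with AllI.IH show ?case by (blast intro: derives.AllI)
next
  case (ExE n G p q)
  have "set (p # map lift G) \<subseteq> set (p # map lift G')" using ExE.prems by auto
  with ExE show ?case by (blast intro: derives.ExE)
next
  case (All2I n G p)
  have "set (map lift2 G) \<subseteq> set (map lift2 G')" using All2I.prems by auto
  with All2I.IH show ?case by (blast intro: derives.All2I)
next
  case (Ex2E n G p q)
  have "set (p # map lift2 G) \<subseteq> set (p # map lift2 G')" using Ex2E.prems by auto
  with Ex2E show ?case by (blast intro: derives.Ex2E)
next
  case (EqSubst n G s t p)
  \<comment> \<open>The formula \<open>p\<close> is supplied by hand, since its instance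
    \<open>inst t p\<close> does not determine it.\<close>
  then show ?case by (blast intro: derives.EqSubst[of n G' s t p])
qed (auto intro: derives.intros)

text \<open>The bound on \<open>f\<close> keeps every witness and instance in scope after renaming;
  \<open>g\<close> carries no bound because subset variables have none in \<open>derives\<close>.
  Arbitrary renamings are treated because a binder turns \<open>f\<close> into
  \<open>scons 0 (Suc \<circ> f)\<close>, and the induction needs a family closed under this
  operation.\<close>

lemma derives_ren:
  assumes "derives n G p" "\<And>i. i < n \<Longrightarrow> f i < m"
  shows "derives m (map (ren f g) G) (ren f g p)"
  using assms
proof (induction arbitrary: f g m rule: derives.induct)
  case (AllI n G p)
  have "derives (Suc m) (map (ren (scons 0 (Suc \<circ> f)) g) (map lift G)) (ren (scons 0 (Suc \<circ> f)) g p)"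
    using AllI.prems by (intro AllI.IH) (auto simp: scons_def split: nat.split)
  \<comment> \<open>Renaming under the binder after lifting equals lifting after renaming: by
    \<open>ren_ren\<close> both are the same composite.\<close>
  then show ?case
    by (auto intro!: derives.AllI simp: ren_ren comp_def)
next
  case (AllE n G p t)
  have "derives m (map (ren f g) G) (ren f g (Forall p))"
    using AllE.prems by (intro AllE.IH)
  from derives.AllE[OF this[simplified], of "f t"] AllE.prems AllE.hyps
  show ?case by (simp add: ren_ren comp_scons scons_Suc_comp)
next
  case (ExI n G t p)
  have "derives m (map (ren f g) G) (ren f g (inst t p))"
    using ExI.prems by (intro ExI.IH)
  then show ?case
    using ExI.prems ExI.hyps by (simp add: derives.ExI[of m _ "f t"] ren_ren comp_scons scons_Suc_comp)
next
  case (ExE n G p q)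
  have 1: "derives (Suc m) (map (ren (scons 0 (Suc \<circ> f)) g) (p # map lift G))
      (ren (scons 0 (Suc \<circ> f)) g (lift q))"
    using ExE.prems by (intro ExE.IH) (auto simp: scons_def split: nat.split)
  have 2: "derives m (map (ren f g) G) (ren f g (Exists p))"
    using ExE.prems by (intro ExE.IH)
  show ?case
    by (rule derives.ExE[of m _ "ren (scons 0 (Suc \<circ> f)) g p"]) (use 1 2 in \<open>simp_all add: ren_ren comp_def\<close>)
next
  case (All2I n G p)
  have "derives m (map (ren f (scons 0 (Suc \<circ> g))) (map lift2 G)) (ren f (scons 0 (Suc \<circ> g)) p)"
    using All2I.prems by (intro All2I.IH)
  then show ?case
    by (auto intro!: derives.All2I simp: ren_ren comp_def)
next
  case (All2E n G p s)
  have "derives m (map (ren f g) G) (ren f g (Forall2 p))"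
    using All2E.prems by (intro All2E.IH)
  from derives.All2E[OF this[simplified], of "g s"]
  show ?case by (simp add: ren_ren comp_scons scons_Suc_comp)
next
  case (Ex2I n G s p)
  have "derives m (map (ren f g) G) (ren f g (inst2 s p))"
    using Ex2I.prems by (intro Ex2I.IH)
  then show ?case
    by (simp add: derives.Ex2I[of m _ "g s"] ren_ren comp_scons scons_Suc_comp)
next
  case (Ex2E n G p q)
  have 1: "derives m (map (ren f g) G) (ren f g (Exists2 p))"
    and 2: "derives m (map (ren f (scons 0 (Suc \<circ> g))) (p # map lift2 G))
      (ren f (scons 0 (Suc \<circ> g)) (lift2 q))"
    using Ex2E.prems by (intro Ex2E.IH; assumption)+
  show ?case
    by (rule derives.Ex2E[of m _ "ren f (scons 0 (Suc \<circ> g)) p"]) (use 1 2 in \<open>simp_all add: ren_ren comp_def\<close>)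
next
  case (EqSubst n G s t p)
  \<comment> \<open>Instantiation commutes with renaming, so the premise about \<open>s\<close> and
    the conclusion about \<open>t\<close> are again two instances of one formula.\<close>
  have *: "ren f g (inst i p) = inst (f i) (ren (scons 0 (Suc \<circ> f)) g p)" for i
    by (simp add: ren_ren comp_scons scons_Suc_comp)
  have "derives m (map (ren f g) G) (ren f g (Eq s t))"
    "derives m (map (ren f g) G) (ren f g (inst s p))"
    using EqSubst.prems by (intro EqSubst.IH; assumption)+
  then show ?case
    unfolding * by (simp add: derives.EqSubst[of m _ "f s"])
next
  case (DisjE n G p q r)
  show ?case
    by (rule derives.DisjE[of m _ "ren f g p" "ren f g q"]) (use DisjE in \<open>simp_all\<close>)
next
  case (ImplE n G p q)
  show ?case
    by (rule derives.ImplE[of m _ "ren f g p"]) (use ImplE in \<open>simp_all\<close>)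
next
  case (Compr n G p)
  then show ?case
    using derives.Compr[of m "map (ren f g) G" "ren (scons 0 (Suc \<circ> f)) g p"]
    by (simp add: ren_ren comp_def)
qed (auto intro: derives.intros)

section \<open>Parametricity of formulas with HOL binders\<close>

text \<open>The levels in scope. Only for these does \<open>eidx d\<close> avoid truncated
  subtraction, so that distinct levels have distinct indices below \<open>d\<close>.\<close>

definition els :: "nat \<Rightarrow> elt set" where "els d = Elt ` {..<d}"
definition sbs :: "nat \<Rightarrow> sub set" where "sbs e = Sub ` {..<e}"

lemma els_mono: "x \<in> els d \<Longrightarrow> d \<le> d' \<Longrightarrow> x \<in> els d'"
  and sbs_mono: "S \<in> sbs e \<Longrightarrow> e \<le> e' \<Longrightarrow> S \<in> sbs e'"
  and Elt_els [simp]: "Elt l \<in> els d \<longleftrightarrow> l < d"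
  and Sub_sbs [simp]: "Sub k \<in> sbs e \<longleftrightarrow> k < e"
  by (auto simp: els_def sbs_def)

lemma eidx_Suc [simp]: "x \<in> els d \<Longrightarrow> eidx (Suc d) x = Suc (eidx d x)"
  and sidx_Suc [simp]: "S \<in> sbs e \<Longrightarrow> sidx (Suc e) S = Suc (sidx e S)"
  by (auto simp: els_def sbs_def)

lemma eidx_add: "x \<in> els d \<Longrightarrow> d \<le> d' \<Longrightarrow> eidx d x + (d' - d) = eidx d' x"
  and sidx_add: "S \<in> sbs e \<Longrightarrow> e \<le> e' \<Longrightarrow> sidx e S + (e' - e) = sidx e' S"
  by (auto simp: els_def sbs_def)

lemma eidx_less: "x \<in> els d \<Longrightarrow> eidx d x < d"
  by (auto simp: els_def)

text \<open>To act on levels, a renaming of indices needs the scope sizes on both sides: the source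
  sizes turn a level into an index, and the target sizes read the image back as a level.\<close>

datatype mor = Mor (emap: "nat \<Rightarrow> nat") (smap: "nat \<Rightarrow> nat")
  (esrc: nat) (ssrc: nat) (etgt: nat) (stgt: nat)

text \<open>The renaming as it acts beneath one more element binder on both sides, with the new
  variable sent to the new variable; \<open>under2\<close> does the same for subset binders.\<close>

definition under :: "mor \<Rightarrow> mor" where
  "under m = Mor (scons 0 (Suc \<circ> emap m)) (smap m) (Suc (esrc m)) (ssrc m) (Suc (etgt m)) (stgt m)"
definition under2 :: "mor \<Rightarrow> mor" where
  "under2 m = Mor (emap m) (scons 0 (Suc \<circ> smap m)) (esrc m) (Suc (ssrc m)) (etgt m) (Suc (stgt m))"

text \<open>The renamings met while descending through any number of binders of either sort. They
  play the part of later worlds in the logical relation: related variables stay related along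
  \<open>mext\<close>.\<close>

inductive mext :: "mor \<Rightarrow> mor \<Rightarrow> bool" for m where
  mext_refl: "mext m m"
| mext_under: "mext m m' \<Longrightarrow> mext m (under m')"
| mext_under2: "mext m m' \<Longrightarrow> mext m (under2 m')"

definition erel :: "mor \<Rightarrow> elt \<Rightarrow> elt \<Rightarrow> bool" where
  "erel m x x' \<longleftrightarrow> x \<in> els (esrc m) \<and> x' \<in> els (etgt m) \<and>
    emap m (eidx (esrc m) x) = eidx (etgt m) x'"
definition srel :: "mor \<Rightarrow> sub \<Rightarrow> sub \<Rightarrow> bool" where
  "srel m S S' \<longleftrightarrow> S \<in> sbs (ssrc m) \<and> S' \<in> sbs (stgt m) \<and>
    smap m (sidx (ssrc m) S) = sidx (stgt m) S'"
definition prel :: "mor \<Rightarrow> prp \<Rightarrow> prp \<Rightarrow> bool" where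
  "prel m p p' \<longleftrightarrow> ren (emap m) (smap m) (p (esrc m) (ssrc m)) = p' (etgt m) (stgt m)"
text \<open>
  The quantification over \<open>mext\<close> lets a relation between bodies be used under further binders.
\<close>

definition crel :: "mor \<Rightarrow> (elt \<Rightarrow> prp) \<Rightarrow> (elt \<Rightarrow> prp) \<Rightarrow> bool" where
  "crel m A A' \<longleftrightarrow> (\<forall>m' x x'. mext m m' \<longrightarrow> erel m' x x' \<longrightarrow> prel m' (A x) (A' x'))"
definition crel2 :: "mor \<Rightarrow> (sub \<Rightarrow> prp) \<Rightarrow> (sub \<Rightarrow> prp) \<Rightarrow> bool" where
  "crel2 m A A' \<longleftrightarrow> (\<forall>m' S S'. mext m m' \<longrightarrow> srel m' S S' \<longrightarrow> prel m' (A S) (A' S'))"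

lemma mext_step: "mext m' m'' \<Longrightarrow> mext m m' \<Longrightarrow> mext m m''"
  by (induction m'' rule: mext.induct) (auto intro: mext.intros)

lemma erel_under: "erel m x x' \<Longrightarrow> erel (under m) x x'"
  and srel_under: "srel m S S' \<Longrightarrow> srel (under m) S S'"
  and erel_under2: "erel m x x' \<Longrightarrow> erel (under2 m) x x'"
  and srel_under2: "srel m S S' \<Longrightarrow> srel (under2 m) S S'"
  and erel_under_new: "erel (under m) (Elt (esrc m)) (Elt (etgt m))"
  and srel_under2_new: "srel (under2 m) (Sub (ssrc m)) (Sub (stgt m))"
  by (auto simp: erel_def srel_def under_def under2_def intro: els_mono sbs_mono)

lemma erel_mext: "mext m m' \<Longrightarrow> erel m x x' \<Longrightarrow> erel m' x x'"
  by (induction rule: mext.induct) (auto intro: erel_under erel_under2)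

lemma srel_mext: "mext m m' \<Longrightarrow> srel m S S' \<Longrightarrow> srel m' S S'"
  by (induction rule: mext.induct) (auto intro: srel_under srel_under2)

lemma crelI: "(\<And>m' x x'. mext m m' \<Longrightarrow> erel m' x x' \<Longrightarrow> prel m' (A x) (A' x')) \<Longrightarrow> crel m A A'"
  by (auto simp: crel_def)
lemma crelD: "crel m A A' \<Longrightarrow> erel m x x' \<Longrightarrow> prel m (A x) (A' x')"
  by (auto simp: crel_def intro: mext_refl)
lemma crel2D: "crel2 m A A' \<Longrightarrow> srel m x x' \<Longrightarrow> prel m (A x) (A' x')"
  by (auto simp: crel2_def intro: mext_refl)
lemma crel2I: "(\<And>m' x x'. mext m m' \<Longrightarrow> srel m' x x' \<Longrightarrow> prel m' (A x) (A' x')) \<Longrightarrow> crel2 m A A'"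
  by (auto simp: crel2_def)

lemma prel_le: "erel m x x' \<Longrightarrow> erel m y y' \<Longrightarrow> prel m (x \<^bold>\<sqsubseteq> y) (x' \<^bold>\<sqsubseteq> y')"
  and prel_eq: "erel m x x' \<Longrightarrow> erel m y y' \<Longrightarrow> prel m (x \<^bold>= y) (x' \<^bold>= y')"
  and prel_mem: "erel m x x' \<Longrightarrow> srel m S S' \<Longrightarrow> prel m (x \<^bold>\<in> S) (x' \<^bold>\<in> S')"
  and prel_conj: "prel m p p' \<Longrightarrow> prel m q q' \<Longrightarrow> prel m (p \<^bold>\<and> q) (p' \<^bold>\<and> q')"
  and prel_disj: "prel m p p' \<Longrightarrow> prel m q q' \<Longrightarrow> prel m (p \<^bold>\<or> q) (p' \<^bold>\<or> q')"
  and prel_imp: "prel m p p' \<Longrightarrow> prel m q q' \<Longrightarrow> prel m (p \<^bold>\<longrightarrow> q) (p' \<^bold>\<longrightarrow> q')"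
  and prel_not: "prel m p p' \<Longrightarrow> prel m (\<^bold>\<not> p) (\<^bold>\<not> p')"
  by (auto simp: prel_def erel_def srel_def le_p_def eq_p_def mem_p_def conj_p_def disj_p_def
      imp_p_def not_p_def)

lemma crel_under: "crel m P P' \<Longrightarrow> prel (under m) (P (Elt (esrc m))) (P' (Elt (etgt m)))"
  unfolding crel_def by (blast intro: mext.intros erel_under_new)
lemma crel2_under2: "crel2 m P P' \<Longrightarrow> prel (under2 m) (P (Sub (ssrc m))) (P' (Sub (stgt m)))"
  unfolding crel2_def by (blast intro: mext.intros srel_under2_new)

text \<open>A quantified formula is its body at the fresh level in the enlarged scope, so relating
  the bodies at \<open>under m\<close> and at the new variable is what renaming the quantifier asks
  for.\<close>

lemma prel_all: "crel m P P' \<Longrightarrow> prel m (all_p P) (all_p P')"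
  and prel_ex: "crel m P P' \<Longrightarrow> prel m (ex_p P) (ex_p P')"
  by (drule crel_under, simp add: prel_def all_p_def ex_p_def under_def)+

lemma prel_all2: "crel2 m P P' \<Longrightarrow> prel m (all2_p P) (all2_p P')"
  and prel_ex2: "crel2 m P P' \<Longrightarrow> prel m (ex2_p P) (ex2_p P')"
  by (drule crel2_under2, simp add: prel_def all2_p_def ex2_p_def under2_def)+

section \<open>Parametricity of the domain-theoretic vocabulary\<close>

lemmas param_logic = prel_le prel_eq prel_mem prel_conj prel_disj prel_imp prel_not
  prel_all prel_ex prel_all2 prel_ex2 crelI crel2I
text \<open>Together with \<open>erel_mext\<close> and \<open>srel_mext\<close> this carries what is
  assumed of parameters beneath the binders passed, so that parametricity of every notion below is
  found by following the shape of its definition.\<close>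

lemma crelD_ext: "crel m A A' \<Longrightarrow> mext m m' \<Longrightarrow> erel m' x x' \<Longrightarrow> prel m' (A x) (A' x')"
  by (simp add: crel_def)
lemma crel_cls: "srel m S S' \<Longrightarrow> crel m (cls S) (cls S')"
  by (assumption | rule param_logic  mext_refl | erule crelD_ext erel_mext srel_mext mext_step)+

lemma prel_decidable: "prel m p p' \<Longrightarrow> prel m (decidable p) (decidable p')"
  unfolding decidable_def by (assumption | rule param_logic  mext_refl | erule crelD_ext erel_mext srel_mext mext_step)+

lemma prel_included: "crel m A A' \<Longrightarrow> crel m C C' \<Longrightarrow> prel m (A \<^bold>\<subseteq> C) (A' \<^bold>\<subseteq> C')"
  unfolding included_def by (assumption | rule param_logic  mext_refl | erule crelD_ext erel_mext srel_mext mext_step)+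

lemma prel_poset: "prel m poset poset"
  unfolding poset_def by (assumption | rule param_logic  mext_refl | erule crelD_ext erel_mext srel_mext mext_step)+

lemma prel_inhabited: "crel m A A' \<Longrightarrow> prel m (inhabited A) (inhabited A')"
  unfolding inhabited_def by (assumption | rule param_logic  mext_refl | erule crelD_ext erel_mext srel_mext mext_step)+

lemma prel_directed: "crel m A A' \<Longrightarrow> prel m (directed A) (directed A')"
  unfolding directed_def by (assumption | rule param_logic prel_inhabited mext_refl | erule crelD_ext erel_mext srel_mext mext_step)+

lemma prel_is_sup: "erel m u u' \<Longrightarrow> crel m A A' \<Longrightarrow> prel m (is_sup u A) (is_sup u' A')"
  unfolding is_sup_def by (assumption | rule param_logic  mext_refl | erule crelD_ext erel_mext srel_mext mext_step)+

lemma prel_is_bottom: "erel m u u' \<Longrightarrow> prel m (is_bottom u) (is_bottom u')"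
  unfolding is_bottom_def by (assumption | rule param_logic  mext_refl | erule crelD_ext erel_mext srel_mext mext_step)+

lemma prel_dcpo: "prel m dcpo dcpo"
  unfolding dcpo_def by (assumption | rule param_logic prel_poset prel_directed prel_is_sup crel_cls mext_refl | erule crelD_ext erel_mext srel_mext mext_step)+

lemma prel_way_below: "erel m x x' \<Longrightarrow> erel m y y' \<Longrightarrow> prel m (x \<^bold>\<lless> y) (x' \<^bold>\<lless> y')"
  unfolding way_below_def by (assumption | rule param_logic prel_directed prel_is_sup crel_cls mext_refl | erule crelD_ext erel_mext srel_mext mext_step)+

lemma prel_basis: "crel m A A' \<Longrightarrow> prel m (basis A) (basis A')"
  unfolding basis_def by (assumption | rule param_logic prel_directed prel_is_sup prel_way_below mext_refl | erule crelD_ext erel_mext srel_mext mext_step)+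

lemma prel_continuous: "prel m continuous continuous"
  unfolding continuous_def by (assumption | rule param_logic crel_cls prel_basis mext_refl | erule crelD_ext erel_mext srel_mext mext_step)+

lemma prel_compact: "erel m x x' \<Longrightarrow> prel m (compact x) (compact x')"
  unfolding compact_def by (assumption | rule param_logic prel_way_below mext_refl | erule crelD_ext erel_mext srel_mext mext_step)+

lemma prel_algebraic: "prel m algebraic algebraic"
  unfolding algebraic_def
  by (assumption | rule param_logic prel_directed prel_is_sup prel_compact mext_refl | erule crelD_ext erel_mext srel_mext mext_step)+

lemma prel_sharp: "erel m x x' \<Longrightarrow> prel m (sharp x) (sharp x')"
  unfolding sharp_def by (assumption | rule param_logic prel_way_below mext_refl | erule crelD_ext erel_mext srel_mext mext_step)+

lemma prel_scott_open: "crel m A A' \<Longrightarrow> prel m (scott_open A) (scott_open A')"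
  unfolding scott_open_def by (assumption | rule param_logic prel_directed prel_is_sup crel_cls mext_refl | erule crelD_ext erel_mext srel_mext mext_step)+

lemma prel_scott_closed: "crel m A A' \<Longrightarrow> prel m (scott_closed A) (scott_closed A')"
  unfolding scott_closed_def
  by (assumption | rule param_logic prel_directed prel_is_sup crel_cls prel_included mext_refl | erule crelD_ext erel_mext srel_mext mext_step)+

lemma prel_is_scott_closure:
  "crel m C C' \<Longrightarrow> crel m A A' \<Longrightarrow> prel m (is_scott_closure C A) (is_scott_closure C' A')"
  unfolding is_scott_closure_def
  by (assumption | rule param_logic crel_cls prel_included prel_scott_closed mext_refl | erule crelD_ext erel_mext srel_mext mext_step)+

section \<open>Forcing\<close>

datatype world = World (edim: nat) (sdim: nat) (hyps: "form list")

abbreviation elems :: "world \<Rightarrow> elt set" where "elems w \<equiv> els (edim w)"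
abbreviation subsets :: "world \<Rightarrow> sub set" where "subsets w \<equiv> sbs (sdim w)"

text \<open>Such a renaming sends each variable in scope at \<open>w\<close> to the one of the same
  level, in scopes at least as large as that of \<open>w\<close>; other levels are
  unconstrained.\<close>

definition fixes_params :: "mor \<Rightarrow> world \<Rightarrow> bool" where
  "fixes_params m w \<longleftrightarrow> (\<forall>x\<in>elems w. erel m x x) \<and> (\<forall>S\<in>subsets w. srel m S S)"

text \<open>A \<open>prp\<close> is an arbitrary HOL function of the scope sizes, which could
  mention variables out of scope or change shape with the depth. Commuting with all renamings that
  fix the names at \<open>w\<close> rules this out: it plays the part of being a well-formed formula
  over the variables of \<open>w\<close>.\<close>

definition good :: "world \<Rightarrow> prp \<Rightarrow> bool" where
  "good w p \<longleftrightarrow> (\<forall>m. fixes_params m w \<longrightarrow> prel m p p)"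
definition goodc :: "world \<Rightarrow> (elt \<Rightarrow> prp) \<Rightarrow> bool" where
  "goodc w A \<longleftrightarrow> (\<forall>m. fixes_params m w \<longrightarrow> crel m A A)"
definition goodc2 :: "world \<Rightarrow> (sub \<Rightarrow> prp) \<Rightarrow> bool" where
  "goodc2 w A \<longleftrightarrow> (\<forall>m. fixes_params m w \<longrightarrow> crel2 m A A)"

text \<open>Passing to a larger scope raises every index by the number of new variables, which
  leaves the level unchanged.\<close>

definition shift :: "world \<Rightarrow> world \<Rightarrow> mor" where
  "shift w v = Mor (\<lambda>i. i + (edim v - edim w)) (\<lambda>k. k + (sdim v - sdim w))
    (edim w) (sdim w) (edim v) (sdim v)"

definition extends :: "world \<Rightarrow> world \<Rightarrow> bool" (infix "\<preceq>" 50) where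
  "w \<preceq> v \<longleftrightarrow> edim w \<le> edim v \<and> sdim w \<le> sdim v \<and>
    ren (emap (shift w v)) (smap (shift w v)) ` set (hyps w) \<subseteq> set (hyps v)"

text \<open>Goodness is built into forcing, so that a forced statement can be moved to extensions
  and decomposed without a separate side condition.\<close>

definition forces :: "world \<Rightarrow> prp \<Rightarrow> bool" ("_ \<Turnstile> _" [51, 5] 5) where
  "(w \<Turnstile> p) \<longleftrightarrow> good w p \<and> derives (edim w) (hyps w) (p (edim w) (sdim w))"

lemma shift_simps [simp]:
  "emap (shift w v) = (\<lambda>i. i + (edim v - edim w))" "smap (shift w v) = (\<lambda>k. k + (sdim v - sdim w))"
  "esrc (shift w v) = edim w" "ssrc (shift w v) = sdim w"
  "etgt (shift w v) = edim v" "stgt (shift w v) = sdim v"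
  by (simp_all add: shift_def)

lemma extends_refl: "w \<preceq> w"
  using ren_id by (auto simp: extends_def id_def)

lemma extends_trans:
  assumes "u \<preceq> v" "v \<preceq> w" shows "u \<preceq> w"
proof -
  \<comment> \<open>Along an increasing chain of scopes the differences add up, so shifts
    compose.\<close>
  have "ren (\<lambda>i. i + (edim w - edim u)) (\<lambda>k. k + (sdim w - sdim u)) p =
    ren (emap (shift v w)) (smap (shift v w)) (ren (emap (shift u v)) (smap (shift u v)) p)" for p
    using assms by (simp add: ren_ren extends_def comp_def)
  with assms show ?thesis
    unfolding extends_def by (auto simp del: shift_simps(1,2)) (auto)
qed

lemma elems_mono: "w \<preceq> v \<Longrightarrow> x \<in> elems w \<Longrightarrow> x \<in> elems v"
  and subsets_mono: "w \<preceq> v \<Longrightarrow> S \<in> subsets w \<Longrightarrow> S \<in> subsets v"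
  by (auto simp: extends_def intro: els_mono sbs_mono)

lemma fixes_params_mono: "w \<preceq> v \<Longrightarrow> fixes_params m v \<Longrightarrow> fixes_params m w"
  by (auto simp: fixes_params_def intro: elems_mono subsets_mono)

lemma good_mono: "w \<preceq> v \<Longrightarrow> good w p \<Longrightarrow> good v p"
  and goodc_mono: "w \<preceq> v \<Longrightarrow> goodc w A \<Longrightarrow> goodc v A"
  and goodc2_mono: "w \<preceq> v \<Longrightarrow> goodc2 w A' \<Longrightarrow> goodc2 v A'"
  by (auto simp: good_def goodc_def goodc2_def intro: fixes_params_mono)

lemma fixes_params_shift: "edim w \<le> edim v \<Longrightarrow> sdim w \<le> sdim v \<Longrightarrow> fixes_params (shift w v) w"
  by (auto simp: fixes_params_def erel_def srel_def eidx_add sidx_add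
      simp del: add_diff_assoc intro: els_mono sbs_mono)

text \<open>A shift fixes the names in scope, so a good \<open>p\<close> read at the larger scope is
  the shifted formula. This is the property of \<open>good\<close> behind monotonicity.\<close>

lemma good_shift:
  assumes "good w p" "edim w \<le> d" "sdim w \<le> e"
  shows "ren (\<lambda>i. i + (d - edim w)) (\<lambda>k. k + (e - sdim w)) (p (edim w) (sdim w)) = p d e"
  using assms fixes_params_shift[of w "World d e []"] by (auto simp: good_def prel_def)

lemma forces_good: "w \<Turnstile> p \<Longrightarrow> good w p"
  by (simp add: forces_def)

text \<open>The derivation is renamed by the shift: its hypotheses become hypotheses of
  \<open>v\<close>, and its conclusion becomes \<open>p\<close> read at \<open>v\<close>.\<close>

lemma forces_mono:
  assumes "w \<preceq> v" "w \<Turnstile> p" shows "v \<Turnstile> p"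
proof -
  have *: "edim w \<le> edim v" "sdim w \<le> sdim v" using assms(1) by (auto simp: extends_def)
  have "derives (edim w) (hyps w) (p (edim w) (sdim w))" using assms by (simp add: forces_def)
  then have "derives (edim v) (map (ren (emap (shift w v)) (smap (shift w v))) (hyps w))
      (ren (emap (shift w v)) (smap (shift w v)) (p (edim w) (sdim w)))"
    by (rule derives_ren) (use * in auto)
  then have "derives (edim v) (hyps v) (p (edim v) (sdim v))"
    using assms * good_shift[of w p "edim v" "sdim v"]
    by (auto simp: extends_def forces_def elim!: derives_weaken)
  with assms show ?thesis by (auto simp: forces_def intro: good_mono)
qed

lemma erel_fixes: "fixes_params m w \<Longrightarrow> x \<in> elems w \<Longrightarrow> erel m x x"
  and srel_fixes: "fixes_params m w \<Longrightarrow> S \<in> subsets w \<Longrightarrow> srel m S S"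
  by (auto simp: fixes_params_def)

lemma goodD: "good w p \<Longrightarrow> fixes_params m w \<Longrightarrow> prel m p p"
  and goodcD: "goodc w A \<Longrightarrow> fixes_params m w \<Longrightarrow> crel m A A"
  and goodc2D: "goodc2 w P \<Longrightarrow> fixes_params m w \<Longrightarrow> crel2 m P P"
  and goodI: "(\<And>m. fixes_params m w \<Longrightarrow> prel m p p) \<Longrightarrow> good w p"
  and goodcI: "(\<And>m. fixes_params m w \<Longrightarrow> crel m A A) \<Longrightarrow> goodc w A"
  and goodc2I: "(\<And>m. fixes_params m w \<Longrightarrow> crel2 m P P) \<Longrightarrow> goodc2 w P"
  by (auto simp: good_def goodc_def goodc2_def)

section \<open>Forcing clauses for the connectives\<close>

lemma good_conjD: "good w (p \<^bold>\<and> q) \<Longrightarrow> good w p \<and> good w q"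
  and good_impD: "good w (p \<^bold>\<longrightarrow> q) \<Longrightarrow> good w p \<and> good w q"
  and good_disjD: "good w (p \<^bold>\<or> q) \<Longrightarrow> good w p \<and> good w q"
  by (auto simp: good_def prel_def conj_p_def imp_p_def disj_p_def)

lemma forces_conj: "(w \<Turnstile> p \<^bold>\<and> q) \<longleftrightarrow> (w \<Turnstile> p) \<and> (w \<Turnstile> q)"
  by (auto simp: forces_def conj_p_def[abs_def] dest: good_conjD[unfolded conj_p_def]
      intro: derives.intros prel_conj[unfolded conj_p_def] goodI dest: goodD)

lemma forces_impD: "w \<Turnstile> p \<^bold>\<longrightarrow> q \<Longrightarrow> w \<Turnstile> p \<Longrightarrow> w \<Turnstile> q"
  using good_impD[of w p q] by (auto simp: forces_def imp_p_def intro: derives.ImplE)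

lemma assume_extends: "w \<preceq> World (edim w) (sdim w) (f # hyps w)"
  using ren_id by (auto simp: extends_def id_def)

text \<open>One extension settles the matter: the world with \<open>p\<close> added to the
  hypotheses, where forcing \<open>q\<close> supplies a derivation of \<open>q\<close> from
  \<open>p\<close>.\<close>

lemma forces_impI:
  assumes "good w p" "good w q" "\<And>v. w \<preceq> v \<Longrightarrow> v \<Turnstile> p \<Longrightarrow> v \<Turnstile> q"
  shows "w \<Turnstile> p \<^bold>\<longrightarrow> q"
proof -
  let ?v = "World (edim w) (sdim w) (p (edim w) (sdim w) # hyps w)"
  have "?v \<Turnstile> p" using good_mono[OF assume_extends assms(1)]
    by (simp add: forces_def derives.assm)
  then have "?v \<Turnstile> q" by (rule assms(3)[OF assume_extends])
  then show ?thesis using assms(1,2)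
    by (auto simp: forces_def imp_p_def intro!: derives.ImplI goodI prel_imp[unfolded imp_p_def] dest: goodD)
qed

definition falsity :: prp where "falsity = (\<lambda>d e. Falsity)"

lemma not_p_falsity: "(\<^bold>\<not> p) = (p \<^bold>\<longrightarrow> falsity)"
  by (simp add: not_p_def imp_p_def falsity_def)

lemma good_falsity: "good w falsity"
  by (simp add: good_def prel_def falsity_def)

lemma falsityE: "w \<Turnstile> falsity \<Longrightarrow> good w p \<Longrightarrow> w \<Turnstile> p"
  by (auto simp: forces_def falsity_def intro: derives.FalsityE)

lemma forces_notI: "good w p \<Longrightarrow> (\<And>v. w \<preceq> v \<Longrightarrow> v \<Turnstile> p \<Longrightarrow> v \<Turnstile> falsity) \<Longrightarrow> w \<Turnstile> \<^bold>\<not> p"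
  unfolding not_p_falsity by (intro forces_impI good_falsity)

lemma forces_notE: "w \<Turnstile> \<^bold>\<not> p \<Longrightarrow> w \<Turnstile> p \<Longrightarrow> good w q \<Longrightarrow> w \<Turnstile> q"
  unfolding not_p_falsity by (blast intro: forces_impD falsityE)

lemma forces_disjI1: "w \<Turnstile> p \<Longrightarrow> good w q \<Longrightarrow> w \<Turnstile> p \<^bold>\<or> q"
  and forces_disjI2: "w \<Turnstile> q \<Longrightarrow> good w p \<Longrightarrow> w \<Turnstile> p \<^bold>\<or> q"
  by (auto simp: forces_def intro!: goodI prel_disj dest: goodD)
    (auto simp: disj_p_def intro: derives.intros)

text \<open>Each branch is tested at the world with one disjunct added as a hypothesis, and the two
  derivations are joined by \<open>DisjE\<close>.\<close>

lemma forces_disjE: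
  assumes "w \<Turnstile> p \<^bold>\<or> q" "good w r"
    and "\<And>v. w \<preceq> v \<Longrightarrow> v \<Turnstile> p \<Longrightarrow> v \<Turnstile> r" "\<And>v. w \<preceq> v \<Longrightarrow> v \<Turnstile> q \<Longrightarrow> v \<Turnstile> r"
  shows "w \<Turnstile> r"
proof -
  let ?v = "\<lambda>p. World (edim w) (sdim w) (p (edim w) (sdim w) # hyps w)"
  have "good w p" "good w q" using good_disjD[OF forces_good[OF assms(1)]] by auto
  then have "?v p \<Turnstile> p" "?v q \<Turnstile> q"
    using good_mono[OF assume_extends] by (auto simp add: forces_def derives.assm)
  then have "?v p \<Turnstile> r" "?v q \<Turnstile> r" by (auto intro: assms(3,4) assume_extends)
  with assms(1,2) show ?thesis
    by (auto simp: forces_def disj_p_def intro: derives.DisjE)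
qed

section \<open>Fresh variables, quantifiers and comprehension\<close>

definition fresh_elt :: "world \<Rightarrow> world" where
  "fresh_elt w = World (Suc (edim w)) (sdim w) (map lift (hyps w))"
definition fresh_sub :: "world \<Rightarrow> world" where
  "fresh_sub w = World (edim w) (Suc (sdim w)) (map lift2 (hyps w))"

lemma fresh_elt_extends: "w \<preceq> fresh_elt w"
  and fresh_sub_extends: "w \<preceq> fresh_sub w"
  by (auto simp: extends_def fresh_elt_def fresh_sub_def id_def)

lemma good_lift: "good w p \<Longrightarrow> lift (p (edim w) (sdim w)) = p (Suc (edim w)) (sdim w)"
  and good_lift2: "good w p \<Longrightarrow> lift2 (p (edim w) (sdim w)) = p (edim w) (Suc (sdim w))"
  using good_shift[of w p "Suc (edim w)" "sdim w"] good_shift[of w p "edim w" "Suc (sdim w)"]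
  by (auto simp: id_def)

text \<open>Instantiating the last bound variable by \<open>t\<close> is a renaming from the scope
  with one more variable back to that of \<open>w\<close>. It fixes the names of \<open>w\<close>
  and relates the new level \<open>edim w\<close> to \<open>t\<close>, so parametricity turns
  \<open>inst\<close> on indices into application of the HOL function to \<open>t\<close>.\<close>

lemma fixes_params_subst:
  assumes "t \<in> elems w"
  defines "m \<equiv> Mor (scons (eidx (edim w) t) id) id (Suc (edim w)) (sdim w) (edim w) (sdim w)"
  shows "fixes_params m w" "erel m (Elt (edim w)) t"
  using assms by (auto simp: fixes_params_def erel_def srel_def intro: els_mono)

lemma fixes_params_subst2:
  assumes "t \<in> subsets w"
  defines "m \<equiv> Mor id (scons (sidx (sdim w) t) id) (edim w) (Suc (sdim w)) (edim w) (sdim w)"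
  shows "fixes_params m w" "srel m (Sub (sdim w)) t"
  using assms by (auto simp: fixes_params_def erel_def srel_def intro: sbs_mono)

lemma goodc_inst:
  assumes "goodc w P" "t \<in> elems w"
  shows "inst (eidx (edim w) t) (P (Elt (edim w)) (Suc (edim w)) (sdim w)) = P t (edim w) (sdim w)"
  using crelD[OF goodcD[OF assms(1) fixes_params_subst(1)[OF assms(2)]] fixes_params_subst(2)[OF assms(2)]]
  by (simp add: prel_def)

lemma goodc2_inst:
  assumes "goodc2 w P" "t \<in> subsets w"
  shows "inst2 (sidx (sdim w) t) (P (Sub (sdim w)) (edim w) (Suc (sdim w))) = P t (edim w) (sdim w)"
  using crel2D[OF goodc2D[OF assms(1) fixes_params_subst2(1)[OF assms(2)]] fixes_params_subst2(2)[OF assms(2)]]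
  by (simp add: prel_def)

lemma good_app: "goodc w P \<Longrightarrow> x \<in> elems w \<Longrightarrow> good w (P x)"
  and good_app2: "goodc2 w P' \<Longrightarrow> S \<in> subsets w \<Longrightarrow> good w (P' S)"
  by (auto intro!: goodI dest!: goodcD goodc2D intro: crelD crel2D erel_fixes srel_fixes)

lemma good_all: "goodc w P \<Longrightarrow> good w (all_p P)"
  and good_ex: "goodc w P \<Longrightarrow> good w (ex_p P)"
  and good_all2: "goodc2 w P' \<Longrightarrow> good w (all2_p P')"
  and good_ex2: "goodc2 w P' \<Longrightarrow> good w (ex2_p P')"
  by (auto simp: good_def goodc_def goodc2_def intro: prel_all prel_ex prel_all2 prel_ex2)

lemma forces_allD: "w \<Turnstile> all_p P \<Longrightarrow> goodc w P \<Longrightarrow> x \<in> elems w \<Longrightarrow> w \<Turnstile> P x"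
  by (auto simp: forces_def all_p_def good_app simp flip: goodc_inst intro: derives.AllE eidx_less)

lemma forces_all2D: "w \<Turnstile> all2_p P \<Longrightarrow> goodc2 w P \<Longrightarrow> S \<in> subsets w \<Longrightarrow> w \<Turnstile> P S"
  by (auto simp: forces_def all2_p_def good_app2 simp flip: goodc2_inst intro: derives.All2E)

lemma forces_exI: "w \<Turnstile> P x \<Longrightarrow> goodc w P \<Longrightarrow> x \<in> elems w \<Longrightarrow> w \<Turnstile> ex_p P"
  by (auto simp: forces_def good_ex) (auto simp: ex_p_def goodc_inst intro!: derives.ExI[of _ _ "eidx (edim w) x"] eidx_less)

lemma forces_ex2I: "w \<Turnstile> P S \<Longrightarrow> goodc2 w P \<Longrightarrow> S \<in> subsets w \<Longrightarrow> w \<Turnstile> ex2_p P"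
  by (auto simp: forces_def good_ex2) (auto simp: ex2_p_def goodc2_inst intro!: derives.Ex2I[of _ _ "sidx (sdim w) S"])

text \<open>The level \<open>edim w\<close> is new at \<open>fresh_elt w\<close>, so forcing the
  body there supplies the premise of \<open>AllI\<close>.\<close>

lemma forces_allI:
  assumes "goodc w P" "\<And>v x. w \<preceq> v \<Longrightarrow> x \<in> elems v \<Longrightarrow> v \<Turnstile> P x"
  shows "w \<Turnstile> all_p P"
  using assms(1) assms(2)[OF fresh_elt_extends, of "Elt (edim w)"]
  by (simp add: forces_def good_all) (auto simp: fresh_elt_def all_p_def intro: derives.AllI)

lemma forces_all2I:
  assumes "goodc2 w P" "\<And>v S. w \<preceq> v \<Longrightarrow> S \<in> subsets v \<Longrightarrow> v \<Turnstile> P S"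
  shows "w \<Turnstile> all2_p P"
  using assms(1) assms(2)[OF fresh_sub_extends, of "Sub (sdim w)"]
  by (simp add: forces_def good_all2) (auto simp: fresh_sub_def all2_p_def intro: derives.All2I)

text \<open>The test world has a generic witness: a fresh element, followed by the hypothesis that
  it satisfies \<open>P\<close>. By \<open>good_lift\<close>, \<open>q\<close> read there is the
  lifted formula that \<open>ExE\<close> demands.\<close>

lemma forces_exE:
  assumes "w \<Turnstile> ex_p P" "goodc w P" "good w q"
    and "\<And>v x. w \<preceq> v \<Longrightarrow> x \<in> elems v \<Longrightarrow> v \<Turnstile> P x \<Longrightarrow> v \<Turnstile> q"
  shows "w \<Turnstile> q"
proof -
  let ?x = "Elt (edim w)" and ?u = "fresh_elt w"
  let ?v = "World (edim ?u) (sdim ?u) (P ?x (edim ?u) (sdim ?u) # hyps ?u)"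
  have u: "w \<preceq> ?v" by (rule extends_trans[OF fresh_elt_extends assume_extends])
  have x: "?x \<in> elems ?v" by (simp add: fresh_elt_def)
  have "?v \<Turnstile> P ?x"
    using good_app[OF goodc_mono[OF u assms(2)] x] by (simp add: forces_def derives.assm)
  then have "?v \<Turnstile> q" using assms(4)[OF u x] by simp
  then show ?thesis
    using assms(1,3) by (auto simp: forces_def ex_p_def fresh_elt_def good_lift intro: derives.ExE)
qed

lemma forces_ex2E:
  assumes "w \<Turnstile> ex2_p P" "goodc2 w P" "good w q"
    and "\<And>v S. w \<preceq> v \<Longrightarrow> S \<in> subsets v \<Longrightarrow> v \<Turnstile> P S \<Longrightarrow> v \<Turnstile> q"
  shows "w \<Turnstile> q"
proof -
  let ?x = "Sub (sdim w)" and ?u = "fresh_sub w"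
  let ?v = "World (edim ?u) (sdim ?u) (P ?x (edim ?u) (sdim ?u) # hyps ?u)"
  have u: "w \<preceq> ?v" by (rule extends_trans[OF fresh_sub_extends assume_extends])
  have x: "?x \<in> subsets ?v" by (simp add: fresh_sub_def)
  have "?v \<Turnstile> P ?x"
    using good_app2[OF goodc2_mono[OF u assms(2)] x] by (simp add: forces_def derives.assm)
  then have "?v \<Turnstile> q" using assms(4)[OF u x] by simp
  then show ?thesis
    using assms(1,3) by (auto simp: forces_def ex2_p_def fresh_sub_def good_lift2 intro: derives.Ex2E)
qed

lemma goodc2_compr: "goodc w A \<Longrightarrow> goodc2 w (\<lambda>S. \<^bold>\<forall>x. x \<^bold>\<in> S \<^bold>\<longleftrightarrow> A x)"
  by (rule goodc2I, drule (1) goodcD)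
    (assumption | rule param_logic | erule crelD_ext erel_mext srel_mext mext_step)+

lemma forces_compr: "goodc w A \<Longrightarrow> w \<Turnstile> (\<^bold>\<exists>\<^sub>2S. \<^bold>\<forall>x. x \<^bold>\<in> S \<^bold>\<longleftrightarrow> A x)"
  \<comment> \<open>The comprehended formula is \<open>A\<close> at a fresh element; by
    \<open>good_lift2\<close> its lifting past the subset binder is \<open>A\<close> read in the
    larger scope.\<close>
  using derives.Compr[of "edim w" "hyps w" "A (Elt (edim w)) (Suc (edim w)) (sdim w)"]
    good_lift2[OF good_app[OF goodc_mono[OF fresh_elt_extends], of w A "Elt (edim w)"]]
  by (simp add: forces_def good_ex2[OF goodc2_compr])
    (simp add: ex2_p_def all_p_def conj_p_def imp_p_def mem_p_def fresh_elt_def)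

lemma provableI: "(\<And>w. w \<Turnstile> p) \<Longrightarrow> \<turnstile> p"
  by (drule meta_spec[of _ "World 0 0 []"]) (simp add: provable_def forces_def)

section \<open>Well-formedness of the classes and formulas used\<close>

lemmas param = param_logic mext_refl prel_decidable prel_included prel_poset prel_inhabited
  prel_directed prel_is_sup prel_is_bottom prel_dcpo prel_way_below prel_basis prel_continuous
  prel_compact prel_algebraic prel_sharp prel_scott_open prel_scott_closed prel_is_scott_closure
lemmas param_step = crelD_ext goodcD erel_fixes srel_fixes erel_mext srel_mext mext_step

lemma goodc_cls: "S \<in> subsets w \<Longrightarrow> goodc w (cls S)"
  and goodc_compact: "goodc w compact"
  and goodc_sharp: "goodc w sharp"
  by (rule goodcI, (assumption | rule param | erule param_step)+)+

lemma goodc_conj: "goodc w A \<Longrightarrow> goodc w C \<Longrightarrow> goodc w (\<lambda>x. A x \<^bold>\<and> C x)"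
  by (rule goodcI, drule (1) goodcD, drule (1) goodcD) (assumption | rule param | erule param_step)+

lemma goodc_imp: "goodc w A \<Longrightarrow> goodc w C \<Longrightarrow> goodc w (\<lambda>x. A x \<^bold>\<longrightarrow> C x)"
  by (rule goodcI, drule (1) goodcD, drule (1) goodcD) (assumption | rule param | erule param_step)+

lemma goodc_above: "x \<in> elems w \<Longrightarrow> goodc w (\<lambda>y. x \<^bold>\<sqsubseteq> y)"
  and goodc_below: "x \<in> elems w \<Longrightarrow> goodc w (\<lambda>y. y \<^bold>\<sqsubseteq> x)"
  and goodc_way_below: "x \<in> elems w \<Longrightarrow> goodc w (\<lambda>y. y \<^bold>\<lless> x)"
  and goodc_way_above: "x \<in> elems w \<Longrightarrow> goodc w (\<lambda>y. x \<^bold>\<lless> y)"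
  and goodc_refl: "goodc w (\<lambda>y. y \<^bold>\<sqsubseteq> y)"
  by (rule goodcI, (assumption | rule param | erule param_step)+)+

lemmas goodc_intros = goodc_cls goodc_compact goodc_sharp goodc_conj goodc_imp goodc_above goodc_below
  goodc_way_below goodc_way_above goodc_refl

lemma good_le: "x \<in> elems w \<Longrightarrow> y \<in> elems w \<Longrightarrow> good w (x \<^bold>\<sqsubseteq> y)"
  and good_eq: "x \<in> elems w \<Longrightarrow> y \<in> elems w \<Longrightarrow> good w (x \<^bold>= y)"
  and good_mem: "x \<in> elems w \<Longrightarrow> S \<in> subsets w \<Longrightarrow> good w (x \<^bold>\<in> S)"
  and good_way_below: "x \<in> elems w \<Longrightarrow> y \<in> elems w \<Longrightarrow> good w (x \<^bold>\<lless> y)"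
  and good_sharp: "x \<in> elems w \<Longrightarrow> good w (sharp x)"
  and good_algebraic: "good w algebraic"
  by (rule goodI, (assumption | rule param | erule param_step)+)+

lemma good_directed: "goodc w A \<Longrightarrow> good w (directed A)"
  and good_inhabited: "goodc w A \<Longrightarrow> good w (inhabited A)"
  and good_scott_open: "goodc w A \<Longrightarrow> good w (scott_open A)"
  and good_scott_closed: "goodc w A \<Longrightarrow> good w (scott_closed A)"
  by (rule goodI, drule (1) goodcD, (assumption | rule param | erule param_step)+)+

lemma good_included: "goodc w A \<Longrightarrow> goodc w C \<Longrightarrow> good w (A \<^bold>\<subseteq> C)"
  by (rule goodI, drule (1) goodcD, drule (1) goodcD, (assumption | rule param | erule param_step)+)

lemma good_conj: "good w p \<Longrightarrow> good w q \<Longrightarrow> good w (p \<^bold>\<and> q)"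
  and good_disj: "good w p \<Longrightarrow> good w q \<Longrightarrow> good w (p \<^bold>\<or> q)"
  and good_imp: "good w p \<Longrightarrow> good w q \<Longrightarrow> good w (p \<^bold>\<longrightarrow> q)"
  and good_not: "good w p \<Longrightarrow> good w (\<^bold>\<not> p)"
  and good_decidable: "good w p \<Longrightarrow> good w (decidable p)"
  by (rule goodI, drule (1) goodD, (drule (1) goodD)?, (assumption | rule param)+)+

lemmas good_intros = good_le good_eq good_mem good_way_below good_sharp good_algebraic good_directed
  good_inhabited good_scott_open good_scott_closed good_included good_conj good_disj good_imp good_not
  good_decidable good_ex good_all

lemma forces_all_impI:
  assumes "goodc w A" "goodc w C" "\<And>v x. w \<preceq> v \<Longrightarrow> x \<in> elems v \<Longrightarrow> v \<Turnstile> A x \<Longrightarrow> v \<Turnstile> C x"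
  shows "w \<Turnstile> \<^bold>\<forall>x. A x \<^bold>\<longrightarrow> C x"
proof (rule forces_allI[OF goodc_imp[OF assms(1,2)]], rule forces_impI)
  fix v x u assume "w \<preceq> v" "x \<in> elems v" "v \<preceq> u" "u \<Turnstile> A x"
  then show "u \<Turnstile> C x" by (blast intro: assms(3) extends_trans elems_mono)
qed (auto intro: good_app goodc_mono assms)

lemma forces_all_impD:
  "w \<Turnstile> \<^bold>\<forall>x. A x \<^bold>\<longrightarrow> C x \<Longrightarrow> w \<Turnstile> A x \<Longrightarrow> goodc w A \<Longrightarrow> goodc w C \<Longrightarrow> x \<in> elems w \<Longrightarrow> w \<Turnstile> C x"
  by (drule forces_allD[OF _ goodc_imp]) (blast dest: forces_impD)+

text \<open>\<open>crel\<close> looks beneath binders, and a renaming that fixes the names of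
  \<open>w\<close> still does so there.\<close>

lemma goodc_const: "good w p \<Longrightarrow> goodc w (\<lambda>_. p)"
  by (auto simp: good_def goodc_def crel_def fixes_params_def intro: erel_mext srel_mext)

text \<open>The upper-bound clause of directedness and both decidability hypotheses have this shape,
  with the two premises placed after both quantifiers.\<close>

lemma forces_all_all_impI:
  assumes "goodc w A" "goodc w (\<lambda>x. \<^bold>\<forall>y. A x \<^bold>\<longrightarrow> A y \<^bold>\<longrightarrow> R x y)"
    and R: "\<And>v x. w \<preceq> v \<Longrightarrow> x \<in> elems v \<Longrightarrow> goodc v (R x)"
    and "\<And>v x y. w \<preceq> v \<Longrightarrow> x \<in> elems v \<Longrightarrow> y \<in> elems v \<Longrightarrow> v \<Turnstile> A x \<Longrightarrow> v \<Turnstile> A y \<Longrightarrow> v \<Turnstile> R x y"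
  shows "w \<Turnstile> \<^bold>\<forall>x. \<^bold>\<forall>y. A x \<^bold>\<longrightarrow> A y \<^bold>\<longrightarrow> R x y"
proof (rule forces_allI[OF assms(2)])
  fix v x assume v: "w \<preceq> v" "x \<in> elems v"
  note A = goodc_mono[OF v(1) assms(1)]
  show "v \<Turnstile> \<^bold>\<forall>y. A x \<^bold>\<longrightarrow> A y \<^bold>\<longrightarrow> R x y"
  proof (rule forces_all_impI[OF goodc_const[OF good_app[OF A v(2)]] goodc_imp[OF A R[OF v]]])
    fix u y assume u: "v \<preceq> u" "y \<in> elems u" "u \<Turnstile> A x"
    have wu: "w \<preceq> u" and x: "x \<in> elems u" using u v by (blast intro: extends_trans elems_mono)+
    show "u \<Turnstile> A y \<^bold>\<longrightarrow> R x y"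
    proof (rule forces_impI)
      show "good u (A y)" "good u (R x y)"
        using goodc_mono[OF wu assms(1)] R[OF wu x] u(2) by (auto intro: good_app)
      fix t assume "u \<preceq> t" "t \<Turnstile> A y"
      then show "t \<Turnstile> R x y"
        using wu x u by (blast intro: assms(4) extends_trans elems_mono forces_mono)
    qed
  qed
qed

lemma forces_all_all_impD:
  assumes "w \<Turnstile> \<^bold>\<forall>x. \<^bold>\<forall>y. A x \<^bold>\<longrightarrow> A y \<^bold>\<longrightarrow> R x y" "w \<Turnstile> A x" "w \<Turnstile> A y"
    and "goodc w A" "goodc w (\<lambda>x. \<^bold>\<forall>y. A x \<^bold>\<longrightarrow> A y \<^bold>\<longrightarrow> R x y)" "goodc w (R x)"
    and "x \<in> elems w" "y \<in> elems w"
  shows "w \<Turnstile> R x y"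
proof -
  have "w \<Turnstile> A y \<^bold>\<longrightarrow> R x y"
    by (rule forces_all_impD[OF forces_allD[OF assms(1,5,7)] assms(2)])
      (intro goodc_const goodc_imp good_app assms)+
  then show ?thesis using assms(3) by (rule forces_impD)
qed

section \<open>Domain theory under forcing\<close>

lemma poset_refl:
  assumes "w \<Turnstile> poset" "x \<in> elems w"
  shows "w \<Turnstile> x \<^bold>\<sqsubseteq> x"
proof -
  have "w \<Turnstile> \<^bold>\<forall>x. x \<^bold>\<sqsubseteq> x"
    using assms(1) unfolding poset_def forces_conj by blast
  then show ?thesis by (rule forces_allD[OF _ goodc_refl assms(2)])
qed

lemma poset_trans:
  assumes "w \<Turnstile> poset" "w \<Turnstile> x \<^bold>\<sqsubseteq> y" "w \<Turnstile> y \<^bold>\<sqsubseteq> z"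
    and "x \<in> elems w" "y \<in> elems w" "z \<in> elems w"
  shows "w \<Turnstile> x \<^bold>\<sqsubseteq> z"
proof -
  have "w \<Turnstile> \<^bold>\<forall>x. \<^bold>\<forall>y. \<^bold>\<forall>z. x \<^bold>\<sqsubseteq> y \<^bold>\<longrightarrow> y \<^bold>\<sqsubseteq> z \<^bold>\<longrightarrow> x \<^bold>\<sqsubseteq> z"
    using assms(1) unfolding poset_def forces_conj by blast
  note all = forces_allD[OF forces_allD[OF forces_allD[OF this]]]
  have "w \<Turnstile> x \<^bold>\<sqsubseteq> y \<^bold>\<longrightarrow> y \<^bold>\<sqsubseteq> z \<^bold>\<longrightarrow> x \<^bold>\<sqsubseteq> z"
    by (rule all) (fact assms | rule goodcI, (insert assms(4-), assumption | rule param | erule param_step)+)+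
  then show ?thesis using assms by (blast dest: forces_impD)
qed

lemma poset_antisym:
  assumes "w \<Turnstile> poset" "w \<Turnstile> x \<^bold>\<sqsubseteq> y" "w \<Turnstile> y \<^bold>\<sqsubseteq> x" "x \<in> elems w" "y \<in> elems w"
  shows "w \<Turnstile> x \<^bold>= y"
proof -
  have "w \<Turnstile> \<^bold>\<forall>x. \<^bold>\<forall>y. x \<^bold>\<sqsubseteq> y \<^bold>\<longrightarrow> y \<^bold>\<sqsubseteq> x \<^bold>\<longrightarrow> x \<^bold>= y"
    using assms(1) unfolding poset_def forces_conj by blast
  note all = forces_allD[OF forces_allD[OF this]]
  have "w \<Turnstile> x \<^bold>\<sqsubseteq> y \<^bold>\<longrightarrow> y \<^bold>\<sqsubseteq> x \<^bold>\<longrightarrow> x \<^bold>= y"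
    by (rule all) (fact assms | rule goodcI, (insert assms(4-), assumption | rule param | erule param_step)+)+
  then show ?thesis using assms by (blast dest: forces_impD)
qed

lemma eq_imp_le:
  assumes "w \<Turnstile> poset" "w \<Turnstile> x \<^bold>= y" "x \<in> elems w" "y \<in> elems w"
  shows "w \<Turnstile> x \<^bold>\<sqsubseteq> y"
proof -
  \<comment> \<open>The formula \<open>x \<sqsubseteq> _\<close> with index \<open>0\<close> as the
    hole and \<open>x\<close> raised past it: its instance at \<open>x\<close> is reflexivity, and
    its instance at \<open>y\<close> is the claim.\<close>
  let ?p = "Le (Suc (eidx (edim w) x)) 0"
  have "derives (edim w) (hyps w) (inst (eidx (edim w) x) ?p)"
    using poset_refl[OF assms(1,3)] by (simp add: forces_def le_p_def)
  with assms(2) have "derives (edim w) (hyps w) (inst (eidx (edim w) y) ?p)"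
    unfolding forces_def eq_p_def by (blast intro: derives.EqSubst)
  then show ?thesis using good_le[OF assms(3,4)] by (simp add: forces_def le_p_def)
qed

lemma is_sup_upper:
  assumes "w \<Turnstile> is_sup u A" "w \<Turnstile> A x" "goodc w A" "u \<in> elems w" "x \<in> elems w"
  shows "w \<Turnstile> x \<^bold>\<sqsubseteq> u"
proof -
  have "w \<Turnstile> \<^bold>\<forall>x. A x \<^bold>\<longrightarrow> x \<^bold>\<sqsubseteq> u"
    using assms(1) unfolding is_sup_def forces_conj by blast
  then show ?thesis
    using assms by (auto intro!: forces_all_impD[where A = A and C = "\<lambda>x. x \<^bold>\<sqsubseteq> u"] goodc_intros)
qed

lemma goodc_upper_bound: "goodc w A \<Longrightarrow> goodc w (\<lambda>t. \<^bold>\<forall>x. A x \<^bold>\<longrightarrow> x \<^bold>\<sqsubseteq> t)"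
  by (rule goodcI, drule (1) goodcD, (assumption | rule param | erule param_step)+)

lemma is_sup_least:
  assumes "w \<Turnstile> is_sup u A" "goodc w A" "u \<in> elems w" "t \<in> elems w"
    and "\<And>v x. w \<preceq> v \<Longrightarrow> x \<in> elems v \<Longrightarrow> v \<Turnstile> A x \<Longrightarrow> v \<Turnstile> x \<^bold>\<sqsubseteq> t"
  shows "w \<Turnstile> u \<^bold>\<sqsubseteq> t"
proof -
  have "w \<Turnstile> \<^bold>\<forall>t. (\<^bold>\<forall>x. A x \<^bold>\<longrightarrow> x \<^bold>\<sqsubseteq> t) \<^bold>\<longrightarrow> u \<^bold>\<sqsubseteq> t"
    using assms(1) unfolding is_sup_def forces_conj by blast
  moreover have "w \<Turnstile> \<^bold>\<forall>x. A x \<^bold>\<longrightarrow> x \<^bold>\<sqsubseteq> t"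
    by (rule forces_all_impI) (auto intro!: goodc_intros assms)
  ultimately show ?thesis
    by (rule forces_all_impD) (intro goodc_upper_bound goodc_intros assms)+
qed

lemma is_supI:
  assumes "goodc w A" "u \<in> elems w"
    and "\<And>v x. w \<preceq> v \<Longrightarrow> x \<in> elems v \<Longrightarrow> v \<Turnstile> A x \<Longrightarrow> v \<Turnstile> x \<^bold>\<sqsubseteq> u"
    and "\<And>v t. w \<preceq> v \<Longrightarrow> t \<in> elems v \<Longrightarrow> v \<Turnstile> \<^bold>\<forall>x. A x \<^bold>\<longrightarrow> x \<^bold>\<sqsubseteq> t \<Longrightarrow> v \<Turnstile> u \<^bold>\<sqsubseteq> t"
  shows "w \<Turnstile> is_sup u A"
  unfolding is_sup_def forces_conj
proof
  show "w \<Turnstile> \<^bold>\<forall>x. A x \<^bold>\<longrightarrow> x \<^bold>\<sqsubseteq> u"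
    by (rule forces_all_impI) (auto intro!: goodc_intros assms)
  show "w \<Turnstile> \<^bold>\<forall>t. (\<^bold>\<forall>x. A x \<^bold>\<longrightarrow> x \<^bold>\<sqsubseteq> t) \<^bold>\<longrightarrow> u \<^bold>\<sqsubseteq> t"
    by (rule forces_all_impI) (auto intro!: goodc_upper_bound goodc_intros assms)
qed

lemma goodc_directed_body:
  "goodc w A \<Longrightarrow> goodc w (\<lambda>x. \<^bold>\<forall>y. A x \<^bold>\<longrightarrow> A y \<^bold>\<longrightarrow> (\<^bold>\<exists>z. A z \<^bold>\<and> x \<^bold>\<sqsubseteq> z \<^bold>\<and> y \<^bold>\<sqsubseteq> z))"
  by (rule goodcI, drule (1) goodcD, (assumption | rule param | erule param_step)+)

lemma goodc_upper:
  "goodc w A \<Longrightarrow> x \<in> elems w \<Longrightarrow> goodc w (\<lambda>y. \<^bold>\<exists>z. A z \<^bold>\<and> x \<^bold>\<sqsubseteq> z \<^bold>\<and> y \<^bold>\<sqsubseteq> z)"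
  by (rule goodcI, drule (1) goodcD, (assumption | rule param | erule param_step)+)

lemma directedE_inh:
  assumes "w \<Turnstile> directed A" "goodc w A" "good w q"
    and "\<And>v x. w \<preceq> v \<Longrightarrow> x \<in> elems v \<Longrightarrow> v \<Turnstile> A x \<Longrightarrow> v \<Turnstile> q"
  shows "w \<Turnstile> q"
proof -
  have "w \<Turnstile> ex_p A" using assms(1) unfolding directed_def inhabited_def forces_conj by blast
  then show ?thesis using assms(2-4) by (rule forces_exE)
qed

lemma directedE:
  assumes "w \<Turnstile> directed A" "w \<Turnstile> A x" "w \<Turnstile> A y" "goodc w A" "x \<in> elems w" "y \<in> elems w" "good w q"
    and "\<And>v z. w \<preceq> v \<Longrightarrow> z \<in> elems v \<Longrightarrow> v \<Turnstile> A z \<Longrightarrow> v \<Turnstile> x \<^bold>\<sqsubseteq> z \<Longrightarrow> v \<Turnstile> y \<^bold>\<sqsubseteq> z \<Longrightarrow> v \<Turnstile> q"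
  shows "w \<Turnstile> q"
proof -
  have "w \<Turnstile> \<^bold>\<forall>x. \<^bold>\<forall>y. A x \<^bold>\<longrightarrow> A y \<^bold>\<longrightarrow> (\<^bold>\<exists>z. A z \<^bold>\<and> x \<^bold>\<sqsubseteq> z \<^bold>\<and> y \<^bold>\<sqsubseteq> z)"
    using assms(1) unfolding directed_def forces_conj by blast
  then have "w \<Turnstile> \<^bold>\<exists>z. A z \<^bold>\<and> x \<^bold>\<sqsubseteq> z \<^bold>\<and> y \<^bold>\<sqsubseteq> z"
    by (rule forces_all_all_impD) (intro goodc_directed_body goodc_upper assms)+
  then show ?thesis
    by (rule forces_exE) (use assms in \<open>auto simp: forces_conj intro!: goodc_intros\<close>)
qed

lemma directedI:
  assumes "goodc w A" "w \<Turnstile> ex_p A"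
    and "\<And>v x y. w \<preceq> v \<Longrightarrow> x \<in> elems v \<Longrightarrow> y \<in> elems v \<Longrightarrow> v \<Turnstile> A x \<Longrightarrow> v \<Turnstile> A y \<Longrightarrow>
      v \<Turnstile> \<^bold>\<exists>z. A z \<^bold>\<and> x \<^bold>\<sqsubseteq> z \<^bold>\<and> y \<^bold>\<sqsubseteq> z"
  shows "w \<Turnstile> directed A"
  unfolding directed_def inhabited_def forces_conj
proof
  show "w \<Turnstile> \<^bold>\<forall>x. \<^bold>\<forall>y. A x \<^bold>\<longrightarrow> A y \<^bold>\<longrightarrow> (\<^bold>\<exists>z. A z \<^bold>\<and> x \<^bold>\<sqsubseteq> z \<^bold>\<and> y \<^bold>\<sqsubseteq> z)"
    by (rule forces_all_all_impI[OF assms(1) goodc_directed_body[OF assms(1)]])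
      (auto intro: goodc_upper goodc_mono assms)
qed (fact assms)

text \<open>Classes that agree in every extension are interchangeable. This lets a subset variable
  with the same members replace a class abstract and, in the algebraic case, lets
  \<open>c \<lless> x\<close> replace \<open>c \<sqsubseteq> x\<close> for compact
  \<open>c\<close>.\<close>

lemma directed_cong:
  assumes "w \<Turnstile> directed A" "goodc w A" "goodc w A'"
    and eq: "\<And>v x. w \<preceq> v \<Longrightarrow> x \<in> elems v \<Longrightarrow> (v \<Turnstile> A x) \<longleftrightarrow> (v \<Turnstile> A' x)"
  shows "w \<Turnstile> directed A'"
proof (rule directedI[OF assms(3)])
  show "w \<Turnstile> ex_p A'"
    using assms(1,2) good_ex[OF assms(3)]
  proof (rule directedE_inh)
    fix v x assume "w \<preceq> v" "x \<in> elems v" "v \<Turnstile> A x"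
    then show "v \<Turnstile> ex_p A'"
      using assms(3) eq by (blast intro: forces_exI goodc_mono)
  qed
next
  fix v x y assume v: "w \<preceq> v" "x \<in> elems v" "y \<in> elems v" "v \<Turnstile> A' x" "v \<Turnstile> A' y"
  have A': "goodc u (\<lambda>z. A' z \<^bold>\<and> x \<^bold>\<sqsubseteq> z \<^bold>\<and> y \<^bold>\<sqsubseteq> z)" if "v \<preceq> u" for u
    by (intro goodc_intros goodc_mono[OF that goodc_mono[OF v(1) assms(3)]] elems_mono[OF that] v)
  show "v \<Turnstile> \<^bold>\<exists>z. A' z \<^bold>\<and> x \<^bold>\<sqsubseteq> z \<^bold>\<and> y \<^bold>\<sqsubseteq> z"
  proof (rule directedE[OF forces_mono[OF v(1) assms(1)]])
    show "v \<Turnstile> A x" "v \<Turnstile> A y" using v eq by blast+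
    show "goodc v A" using v assms(2) by (blast intro: goodc_mono)
    show "good v (\<^bold>\<exists>z. A' z \<^bold>\<and> x \<^bold>\<sqsubseteq> z \<^bold>\<and> y \<^bold>\<sqsubseteq> z)" by (intro good_ex A' extends_refl)
    fix u z assume u: "v \<preceq> u" "z \<in> elems u" "u \<Turnstile> A z" "u \<Turnstile> x \<^bold>\<sqsubseteq> z" "u \<Turnstile> y \<^bold>\<sqsubseteq> z"
    then have "u \<Turnstile> A' z" using v eq by (blast intro: extends_trans)
    with u show "u \<Turnstile> \<^bold>\<exists>z. A' z \<^bold>\<and> x \<^bold>\<sqsubseteq> z \<^bold>\<and> y \<^bold>\<sqsubseteq> z"
      by (intro forces_exI[OF _ A']) (auto simp: forces_conj)
  qed (use v in auto)
qed

lemma is_sup_cong: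
  assumes "w \<Turnstile> is_sup u A" "goodc w A" "goodc w A'" "u \<in> elems w"
    and eq: "\<And>v x. w \<preceq> v \<Longrightarrow> x \<in> elems v \<Longrightarrow> (v \<Turnstile> A x) \<longleftrightarrow> (v \<Turnstile> A' x)"
  shows "w \<Turnstile> is_sup u A'"
proof (rule is_supI[OF assms(3,4)])
  fix v x assume "w \<preceq> v" "x \<in> elems v" "v \<Turnstile> A' x"
  then show "v \<Turnstile> x \<^bold>\<sqsubseteq> u"
    using assms eq by (blast intro: is_sup_upper[where A = A] forces_mono goodc_mono elems_mono)
next
  fix v t assume v: "w \<preceq> v" "t \<in> elems v" "v \<Turnstile> \<^bold>\<forall>x. A' x \<^bold>\<longrightarrow> x \<^bold>\<sqsubseteq> t"
  show "v \<Turnstile> u \<^bold>\<sqsubseteq> t"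
  proof (rule is_sup_least[OF forces_mono[OF v(1) assms(1)] goodc_mono[OF v(1) assms(2)]])
    fix v' x assume v': "v \<preceq> v'" "x \<in> elems v'" "v' \<Turnstile> A x"
    then have "v' \<Turnstile> A' x" using v eq by (blast intro: extends_trans)
    then show "v' \<Turnstile> x \<^bold>\<sqsubseteq> t"
      using v v' assms(3)
      by (intro forces_all_impD[OF forces_mono[OF v'(1) v(3)]])
        (auto intro!: goodc_intros intro: goodc_mono elems_mono)
  qed (use v assms(4) elems_mono in auto)
qed

lemma comprehensionE:
  assumes "goodc w A" "good w q"
    and "\<And>v S. w \<preceq> v \<Longrightarrow> S \<in> subsets v \<Longrightarrow>
      (\<And>u x. v \<preceq> u \<Longrightarrow> x \<in> elems u \<Longrightarrow> (u \<Turnstile> x \<^bold>\<in> S) \<longleftrightarrow> (u \<Turnstile> A x)) \<Longrightarrow> v \<Turnstile> q"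
  shows "w \<Turnstile> q"
proof (rule forces_ex2E[OF forces_compr goodc2_compr])
  fix v S assume v: "w \<preceq> v" "S \<in> subsets v" "v \<Turnstile> \<^bold>\<forall>x. x \<^bold>\<in> S \<^bold>\<longleftrightarrow> A x"
  show "v \<Turnstile> q"
  proof (rule assms(3)[OF v(1,2)])
    fix u x assume u: "v \<preceq> u" "x \<in> elems u"
    then have "goodc u A" "S \<in> subsets u"
      using v assms(1) by (blast intro: goodc_mono subsets_mono)+
    then have "u \<Turnstile> x \<^bold>\<in> S \<^bold>\<longleftrightarrow> A x"
      by (intro forces_allD[OF forces_mono[OF u(1) v(3)]] goodc_intros u)
    then show "(u \<Turnstile> x \<^bold>\<in> S) \<longleftrightarrow> (u \<Turnstile> A x)"
      unfolding forces_conj by (blast dest: forces_impD)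
  qed
qed (fact assms)+

text \<open>The definitions of \<open>\<lless>\<close>, Scott open and Scott closed quantify over
  subset variables only; comprehension gives a directed class with a supremum a name to which they
  apply.\<close>

lemma directed_supE:
  assumes "w \<Turnstile> directed A" "w \<Turnstile> is_sup u A" "goodc w A" "u \<in> elems w" "good w q"
    and "\<And>v S. w \<preceq> v \<Longrightarrow> S \<in> subsets v \<Longrightarrow> v \<Turnstile> directed (cls S) \<Longrightarrow> v \<Turnstile> is_sup u (cls S) \<Longrightarrow>
      (\<And>t x. v \<preceq> t \<Longrightarrow> x \<in> elems t \<Longrightarrow> (t \<Turnstile> x \<^bold>\<in> S) \<longleftrightarrow> (t \<Turnstile> A x)) \<Longrightarrow> v \<Turnstile> q"
  shows "w \<Turnstile> q"
proof (rule comprehensionE[OF assms(3,5)])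
  fix v S assume v: "w \<preceq> v" "S \<in> subsets v"
    and eq: "\<And>t x. v \<preceq> t \<Longrightarrow> x \<in> elems t \<Longrightarrow> (t \<Turnstile> x \<^bold>\<in> S) \<longleftrightarrow> (t \<Turnstile> A x)"
  \<comment> \<open>Facts and names available at \<open>w\<close> are carried to \<open>v\<close>
    before they are used there; the same pattern recurs in the proofs below.\<close>
  note up = forces_mono[OF v(1)] goodc_mono[OF v(1)] elems_mono[OF v(1)]
  show "v \<Turnstile> q"
  proof (rule assms(6)[OF v _ _ eq])
    show "v \<Turnstile> directed (cls S)"
      by (rule directed_cong[OF up(1)[OF assms(1)] up(2)[OF assms(3)]]) (use v eq in \<open>auto intro: goodc_cls\<close>)
    show "v \<Turnstile> is_sup u (cls S)"
      by (rule is_sup_cong[OF up(1)[OF assms(2)] up(2)[OF assms(3)]])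
        (use v eq up(3)[OF assms(4)] in \<open>auto intro: goodc_cls\<close>)
  qed
qed

section \<open>The way-below relation and interpolation\<close>

lemma way_belowI:
  assumes "x \<in> elems w" "y \<in> elems w"
    and "\<And>v S u. w \<preceq> v \<Longrightarrow> S \<in> subsets v \<Longrightarrow> u \<in> elems v \<Longrightarrow> v \<Turnstile> directed (cls S) \<Longrightarrow>
      v \<Turnstile> is_sup u (cls S) \<Longrightarrow> v \<Turnstile> y \<^bold>\<sqsubseteq> u \<Longrightarrow> v \<Turnstile> \<^bold>\<exists>s. s \<^bold>\<in> S \<^bold>\<and> x \<^bold>\<sqsubseteq> s"
  shows "w \<Turnstile> x \<^bold>\<lless> y"
  unfolding way_below_def
proof (rule forces_all2I)
  show "goodc2 w (\<lambda>S. directed (cls S) \<^bold>\<longrightarrow>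
    (\<^bold>\<forall>u. is_sup u (cls S) \<^bold>\<longrightarrow> y \<^bold>\<sqsubseteq> u \<^bold>\<longrightarrow> (\<^bold>\<exists>s. s \<^bold>\<in> S \<^bold>\<and> x \<^bold>\<sqsubseteq> s)))"
    by (rule goodc2I) (insert assms(1,2), (assumption | rule param | erule param_step)+)
  fix v S assume v: "w \<preceq> v" "S \<in> subsets v"
  have xy: "x \<in> elems v" "y \<in> elems v" using elems_mono[OF v(1)] assms(1,2) by auto
  have good: "goodc v (\<lambda>u. is_sup u (cls S))"
    "goodc v (\<lambda>u. y \<^bold>\<sqsubseteq> u \<^bold>\<longrightarrow> (\<^bold>\<exists>s. s \<^bold>\<in> S \<^bold>\<and> x \<^bold>\<sqsubseteq> s))"
    "good v (\<^bold>\<forall>u. is_sup u (cls S) \<^bold>\<longrightarrow> y \<^bold>\<sqsubseteq> u \<^bold>\<longrightarrow> (\<^bold>\<exists>s. s \<^bold>\<in> S \<^bold>\<and> x \<^bold>\<sqsubseteq> s))"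
    "good v (directed (cls S))"
    by ((rule goodcI goodI, insert v(2) xy, (assumption | rule param | erule param_step)+)+)
  show "v \<Turnstile> directed (cls S) \<^bold>\<longrightarrow>
    (\<^bold>\<forall>u. is_sup u (cls S) \<^bold>\<longrightarrow> y \<^bold>\<sqsubseteq> u \<^bold>\<longrightarrow> (\<^bold>\<exists>s. s \<^bold>\<in> S \<^bold>\<and> x \<^bold>\<sqsubseteq> s))"
  proof (rule forces_impI[OF good(4,3)], rule forces_all_impI)
    fix v1 assume v1: "v \<preceq> v1" "v1 \<Turnstile> directed (cls S)"
    show "goodc v1 (\<lambda>u. is_sup u (cls S))" "goodc v1 (\<lambda>u. y \<^bold>\<sqsubseteq> u \<^bold>\<longrightarrow> (\<^bold>\<exists>s. s \<^bold>\<in> S \<^bold>\<and> x \<^bold>\<sqsubseteq> s))"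
      using good v1 by (blast intro: goodc_mono)+
    fix v2 u assume v2: "v1 \<preceq> v2" "u \<in> elems v2" "v2 \<Turnstile> is_sup u (cls S)"
    have "v \<preceq> v2" using v1 v2 by (blast intro: extends_trans)
    show "v2 \<Turnstile> y \<^bold>\<sqsubseteq> u \<^bold>\<longrightarrow> (\<^bold>\<exists>s. s \<^bold>\<in> S \<^bold>\<and> x \<^bold>\<sqsubseteq> s)"
    proof (rule forces_impI)
      show "good v2 (y \<^bold>\<sqsubseteq> u)" "good v2 (\<^bold>\<exists>s. s \<^bold>\<in> S \<^bold>\<and> x \<^bold>\<sqsubseteq> s)"
        using elems_mono[OF \<open>v \<preceq> v2\<close>] subsets_mono[OF \<open>v \<preceq> v2\<close>] v xy v2
        by (auto intro!: good_intros goodc_intros)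
      fix v3 assume "v2 \<preceq> v3" "v3 \<Turnstile> y \<^bold>\<sqsubseteq> u"
      then show "v3 \<Turnstile> \<^bold>\<exists>s. s \<^bold>\<in> S \<^bold>\<and> x \<^bold>\<sqsubseteq> s"
        using v v1 v2 by (intro assms(3)) (blast intro: extends_trans forces_mono elems_mono subsets_mono)+
    qed
  qed
qed

text \<open>The class \<open>A\<close> is named by a subset variable, at which the definition of
  \<open>\<lless>\<close> is instantiated; \<open>\<lless>\<close> can thus be applied directly to
  class abstracts.\<close>

lemma way_belowE:
  assumes "w \<Turnstile> x \<^bold>\<lless> y" "w \<Turnstile> directed A" "w \<Turnstile> is_sup u A" "w \<Turnstile> y \<^bold>\<sqsubseteq> u"
    and "goodc w A" "x \<in> elems w" "y \<in> elems w" "u \<in> elems w" "good w q"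
    and "\<And>v s. w \<preceq> v \<Longrightarrow> s \<in> elems v \<Longrightarrow> v \<Turnstile> A s \<Longrightarrow> v \<Turnstile> x \<^bold>\<sqsubseteq> s \<Longrightarrow> v \<Turnstile> q"
  shows "w \<Turnstile> q"
proof (rule directed_supE[OF assms(2,3,5,8,9)])
  fix v S assume v: "w \<preceq> v" "S \<in> subsets v"
    and S: "v \<Turnstile> directed (cls S)" "v \<Turnstile> is_sup u (cls S)"
    and eq: "\<And>t x. v \<preceq> t \<Longrightarrow> x \<in> elems t \<Longrightarrow> (t \<Turnstile> x \<^bold>\<in> S) \<longleftrightarrow> (t \<Turnstile> A x)"
  note el = assms(6-8)[THEN elems_mono[OF v(1)]]
  have good: "goodc2 v (\<lambda>S. directed (cls S) \<^bold>\<longrightarrow>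
      (\<^bold>\<forall>u. is_sup u (cls S) \<^bold>\<longrightarrow> y \<^bold>\<sqsubseteq> u \<^bold>\<longrightarrow> (\<^bold>\<exists>s. s \<^bold>\<in> S \<^bold>\<and> x \<^bold>\<sqsubseteq> s)))"
    "goodc v (\<lambda>u. is_sup u (cls S))" "goodc v (\<lambda>u. y \<^bold>\<sqsubseteq> u \<^bold>\<longrightarrow> (\<^bold>\<exists>s. s \<^bold>\<in> S \<^bold>\<and> x \<^bold>\<sqsubseteq> s))"
    by ((rule goodcI goodc2I, insert v(2) el, (assumption | rule param | erule param_step)+)+)
  note 1 = forces_all2D[OF forces_mono[OF v(1) assms(1)[unfolded way_below_def]] good(1) v(2)]
  have "v \<Turnstile> \<^bold>\<exists>s. s \<^bold>\<in> S \<^bold>\<and> x \<^bold>\<sqsubseteq> s"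
    using forces_all_impD[OF forces_impD[OF 1 S(1)] S(2) good(2,3) el(3)] forces_mono[OF v(1) assms(4)]
    by (rule forces_impD)
  then show "v \<Turnstile> q"
  proof (rule forces_exE)
    fix t s assume t: "v \<preceq> t" "s \<in> elems t" "t \<Turnstile> s \<^bold>\<in> S \<^bold>\<and> x \<^bold>\<sqsubseteq> s"
    then show "t \<Turnstile> q"
      using v eq unfolding forces_conj by (blast intro: assms(10) extends_trans)
  qed (use v el assms(9) in \<open>auto intro!: goodc_intros intro: good_mono\<close>)
qed

text \<open>A directed set with supremum above \<open>t\<close> has supremum above \<open>z\<close>,
  so some member is above \<open>y\<close> and hence above \<open>x\<close>.\<close>

lemma way_below_mono:
  assumes "w \<Turnstile> poset" "w \<Turnstile> x \<^bold>\<sqsubseteq> y" "w \<Turnstile> y \<^bold>\<lless> z" "w \<Turnstile> z \<^bold>\<sqsubseteq> t"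
    and "x \<in> elems w" "y \<in> elems w" "z \<in> elems w" "t \<in> elems w"
  shows "w \<Turnstile> x \<^bold>\<lless> t"
proof (rule way_belowI)
  fix v S u assume v: "w \<preceq> v" "S \<in> subsets v" "u \<in> elems v"
    "v \<Turnstile> directed (cls S)" "v \<Turnstile> is_sup u (cls S)" "v \<Turnstile> t \<^bold>\<sqsubseteq> u"
  note el = assms(5-8)[THEN elems_mono[OF v(1)]]
  note up = assms(1-4)[THEN forces_mono[OF v(1)]]
  show "v \<Turnstile> \<^bold>\<exists>s. s \<^bold>\<in> S \<^bold>\<and> x \<^bold>\<sqsubseteq> s"
  proof (rule way_belowE[OF up(3) v(4,5)])
    show "v \<Turnstile> z \<^bold>\<sqsubseteq> u" using poset_trans[OF up(1,4) v(6)] el v by blast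
    fix v' s assume v': "v \<preceq> v'" "s \<in> elems v'" "v' \<Turnstile> s \<^bold>\<in> S" "v' \<Turnstile> y \<^bold>\<sqsubseteq> s"
    have "v' \<Turnstile> x \<^bold>\<sqsubseteq> s"
      using up(1,2)[THEN forces_mono[OF v'(1)]] el[THEN elems_mono[OF v'(1)]] v'
      by (blast intro: poset_trans)
    then show "v' \<Turnstile> \<^bold>\<exists>s. s \<^bold>\<in> S \<^bold>\<and> x \<^bold>\<sqsubseteq> s"
      using v' el[THEN elems_mono[OF v'(1)]] subsets_mono[OF v'(1) v(2)]
      by (auto intro!: forces_exI[of _ _ s] goodc_intros simp: forces_conj)
  qed (use v el in \<open>auto intro!: goodc_intros good_intros\<close>)
qed (use assms in auto)

lemma basisD:
  assumes "w \<Turnstile> basis A" "goodc w A" "x \<in> elems w"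
  shows "w \<Turnstile> directed (\<lambda>b. A b \<^bold>\<and> b \<^bold>\<lless> x)" "w \<Turnstile> is_sup x (\<lambda>b. A b \<^bold>\<and> b \<^bold>\<lless> x)"
proof -
  have "goodc w (\<lambda>x. directed (\<lambda>b. A b \<^bold>\<and> b \<^bold>\<lless> x) \<^bold>\<and> is_sup x (\<lambda>b. A b \<^bold>\<and> b \<^bold>\<lless> x))"
    by (rule goodcI, drule goodcD[OF assms(2)]) (assumption | rule param | erule param_step)+
  from forces_allD[OF assms(1)[unfolded basis_def] this assms(3)]
  show "w \<Turnstile> directed (\<lambda>b. A b \<^bold>\<and> b \<^bold>\<lless> x)" "w \<Turnstile> is_sup x (\<lambda>b. A b \<^bold>\<and> b \<^bold>\<lless> x)"
    by (auto simp: forces_conj)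
qed

text \<open>The elements below \<open>y\<close> form a directed class with supremum
  \<open>y\<close>, so \<open>x\<close> lies below one of them.\<close>

lemma way_below_imp_le:
  assumes "w \<Turnstile> poset" "w \<Turnstile> x \<^bold>\<lless> y" "x \<in> elems w" "y \<in> elems w"
  shows "w \<Turnstile> x \<^bold>\<sqsubseteq> y"
proof (rule way_belowE[OF assms(2), of "\<lambda>z. z \<^bold>\<sqsubseteq> y" y])
  show refl: "w \<Turnstile> y \<^bold>\<sqsubseteq> y" by (rule poset_refl) fact+
  show "goodc w (\<lambda>z. z \<^bold>\<sqsubseteq> y)" by (intro goodc_intros assms)
  then show "w \<Turnstile> directed (\<lambda>z. z \<^bold>\<sqsubseteq> y)"
  proof (rule directedI)
    show "w \<Turnstile> \<^bold>\<exists>z. z \<^bold>\<sqsubseteq> y" by (rule forces_exI[where P = "\<lambda>z. z \<^bold>\<sqsubseteq> y", OF refl]) (intro goodc_intros assms)+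
    fix v a b assume v: "w \<preceq> v" "a \<in> elems v" "b \<in> elems v" "v \<Turnstile> a \<^bold>\<sqsubseteq> y" "v \<Turnstile> b \<^bold>\<sqsubseteq> y"
    then show "v \<Turnstile> \<^bold>\<exists>z. z \<^bold>\<sqsubseteq> y \<^bold>\<and> a \<^bold>\<sqsubseteq> z \<^bold>\<and> b \<^bold>\<sqsubseteq> z"
      using elems_mono[OF v(1) assms(4)] forces_mono[OF v(1) refl]
      by (auto intro!: forces_exI[of _ _ y] goodc_intros simp: forces_conj)
  qed
  show "w \<Turnstile> is_sup y (\<lambda>z. z \<^bold>\<sqsubseteq> y)"
  proof (rule is_supI)
    fix v t assume v: "w \<preceq> v" "t \<in> elems v" "v \<Turnstile> \<^bold>\<forall>z. z \<^bold>\<sqsubseteq> y \<^bold>\<longrightarrow> z \<^bold>\<sqsubseteq> t"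
    then show "v \<Turnstile> y \<^bold>\<sqsubseteq> t"
      using elems_mono[OF v(1) assms(4)] forces_mono[OF v(1) refl]
      by (auto intro!: forces_all_impD[OF v(3)] goodc_intros)
  qed (auto intro!: goodc_intros assms)
  fix v s assume v: "w \<preceq> v" "s \<in> elems v" "v \<Turnstile> s \<^bold>\<sqsubseteq> y" "v \<Turnstile> x \<^bold>\<sqsubseteq> s"
  then show "v \<Turnstile> x \<^bold>\<sqsubseteq> y"
    using assms by (blast intro: poset_trans forces_mono elems_mono)
qed (auto intro!: good_intros assms)

lemma goodc_twice_below:
  "goodc w A \<Longrightarrow> z \<in> elems w \<Longrightarrow>
    goodc w (\<lambda>b. A b \<^bold>\<and> (\<^bold>\<exists>c. (A c \<^bold>\<and> c \<^bold>\<lless> z) \<^bold>\<and> b \<^bold>\<lless> c))"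
  by (rule goodcI, drule (1) goodcD) (assumption | rule param | erule param_step)+

lemma twice_belowI:
  assumes "w \<Turnstile> A b" "w \<Turnstile> A c" "w \<Turnstile> c \<^bold>\<lless> z" "w \<Turnstile> b \<^bold>\<lless> c" "goodc w A" "b \<in> elems w" "c \<in> elems w" "z \<in> elems w"
  shows "w \<Turnstile> A b \<^bold>\<and> (\<^bold>\<exists>c. (A c \<^bold>\<and> c \<^bold>\<lless> z) \<^bold>\<and> b \<^bold>\<lless> c)"
  using assms by (auto simp: forces_conj intro!: forces_exI[of _ _ c] goodc_intros)

lemma twice_belowE:
  assumes "w \<Turnstile> A b \<^bold>\<and> (\<^bold>\<exists>c. (A c \<^bold>\<and> c \<^bold>\<lless> z) \<^bold>\<and> b \<^bold>\<lless> c)"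
    and "goodc w A" "b \<in> elems w" "z \<in> elems w" "good w q"
    and "\<And>v c. w \<preceq> v \<Longrightarrow> c \<in> elems v \<Longrightarrow> v \<Turnstile> A b \<Longrightarrow> v \<Turnstile> A c \<Longrightarrow> v \<Turnstile> c \<^bold>\<lless> z \<Longrightarrow> v \<Turnstile> b \<^bold>\<lless> c \<Longrightarrow> v \<Turnstile> q"
  shows "w \<Turnstile> q"
proof -
  have A: "w \<Turnstile> A b" and ex: "w \<Turnstile> \<^bold>\<exists>c. (A c \<^bold>\<and> c \<^bold>\<lless> z) \<^bold>\<and> b \<^bold>\<lless> c"
    using assms(1) by (auto simp: forces_conj)
  show ?thesis
    by (rule forces_exE[OF ex])
      (use assms(2-6) A forces_mono in \<open>auto simp: forces_conj intro!: goodc_intros\<close>)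
qed

text \<open>Two members come with \<open>b1 \<lless> c1\<close> and \<open>b2 \<lless> c2\<close>,
  where \<open>c1\<close> and \<open>c2\<close> are way below \<open>z\<close>. Directedness of the
  basis is used twice: at \<open>z\<close> it gives \<open>c \<lless> z\<close> above
  \<open>c1\<close> and \<open>c2\<close>, and at \<open>c\<close>, where now
  \<open>b1 \<lless> c\<close> and \<open>b2 \<lless> c\<close>, it gives
  \<open>b \<lless> c\<close> above \<open>b1\<close> and \<open>b2\<close>. Then \<open>c\<close>
  witnesses that \<open>b\<close> is a member.\<close>

lemma directed_twice_below:
  assumes "w \<Turnstile> poset" "w \<Turnstile> basis A" "goodc w A" "z \<in> elems w"
  shows "w \<Turnstile> directed (\<lambda>b. A b \<^bold>\<and> (\<^bold>\<exists>c. (A c \<^bold>\<and> c \<^bold>\<lless> z) \<^bold>\<and> b \<^bold>\<lless> c))" (is "w \<Turnstile> directed ?T")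
proof (rule directedI[OF goodc_twice_below[OF assms(3,4)]])
  have T: "goodc v ?T" if "w \<preceq> v" for v
    using that assms by (intro goodc_twice_below) (auto intro: goodc_mono elems_mono)
  \<comment> \<open>Inhabited: take a basis element \<open>c \<lless> z\<close>, then a basis
    element \<open>b \<lless> c\<close>.\<close>
  show "w \<Turnstile> ex_p ?T"
  proof (rule directedE_inh[OF basisD(1)[OF assms(2,3,4)] _ good_ex[OF T[OF extends_refl]]])
    fix v c assume v: "w \<preceq> v" "c \<in> elems v" "v \<Turnstile> A c \<^bold>\<and> c \<^bold>\<lless> z"
    note up = assms(2)[THEN forces_mono[OF v(1)]] goodc_mono[OF v(1) assms(3)] elems_mono[OF v(1) assms(4)]
    show "v \<Turnstile> ex_p ?T"
    proof (rule directedE_inh[OF basisD(1)[OF up(1,2) v(2)] _ good_ex[OF T[OF v(1)]]])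
      fix u b assume u: "v \<preceq> u" "b \<in> elems u" "u \<Turnstile> A b \<^bold>\<and> b \<^bold>\<lless> c"
      show "u \<Turnstile> ex_p ?T"
        by (rule forces_exI[OF _ T u(2)], rule twice_belowI[of _ _ _ c])
          (use u v up forces_mono[OF u(1)] in
            \<open>auto simp: forces_conj intro: extends_trans goodc_mono elems_mono\<close>)
    qed (use up v in \<open>auto intro!: goodc_intros\<close>)
  qed (use assms in \<open>auto intro!: goodc_intros\<close>)
  fix v b1 b2 assume v: "w \<preceq> v" "b1 \<in> elems v" "b2 \<in> elems v" "v \<Turnstile> ?T b1" "v \<Turnstile> ?T b2"
  let ?goal = "\<^bold>\<exists>b. ?T b \<^bold>\<and> b1 \<^bold>\<sqsubseteq> b \<^bold>\<and> b2 \<^bold>\<sqsubseteq> b"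
  have goodc_goal: "goodc u (\<lambda>b. ?T b \<^bold>\<and> b1 \<^bold>\<sqsubseteq> b \<^bold>\<and> b2 \<^bold>\<sqsubseteq> b)" if "v \<preceq> u" for u
    using that v by (intro goodc_conj goodc_above T) (auto intro: extends_trans elems_mono)
  note good_goal = good_ex[OF goodc_goal]
  have A: "goodc u A" and z: "z \<in> elems u" and po: "u \<Turnstile> poset" and ba: "u \<Turnstile> basis A" if "v \<preceq> u" for u
    using that v(1) assms by (blast intro: goodc_mono elems_mono forces_mono extends_trans)+
  show "v \<Turnstile> ?goal"
  proof (rule twice_belowE[OF v(4) A[OF extends_refl] v(2) z[OF extends_refl] good_goal[OF extends_refl]])
    fix v1 c1 assume v1: "v \<preceq> v1" "c1 \<in> elems v1" "v1 \<Turnstile> A b1" "v1 \<Turnstile> A c1" "v1 \<Turnstile> c1 \<^bold>\<lless> z" "v1 \<Turnstile> b1 \<^bold>\<lless> c1"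
    show "v1 \<Turnstile> ?goal"
    proof (rule twice_belowE[OF forces_mono[OF v1(1) v(5)] A[OF v1(1)] elems_mono[OF v1(1) v(3)] z[OF v1(1)]
          good_goal[OF v1(1)]])
      fix v2 c2 assume v2: "v1 \<preceq> v2" "c2 \<in> elems v2" "v2 \<Turnstile> A b2" "v2 \<Turnstile> A c2" "v2 \<Turnstile> c2 \<^bold>\<lless> z" "v2 \<Turnstile> b2 \<^bold>\<lless> c2"
      have vv2: "v \<preceq> v2" using v1 v2 by (blast intro: extends_trans)
      note up2 = v1(3-)[THEN forces_mono[OF v2(1)]] elems_mono[OF v2(1) v1(2)] v(2,3)[THEN elems_mono[OF vv2]]
      show "v2 \<Turnstile> ?goal"
      proof (rule directedE[OF basisD(1)[OF ba A z], OF vv2 vv2 vv2 _ _ _ _ _ good_goal[OF vv2]])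
        show "v2 \<Turnstile> A c1 \<^bold>\<and> c1 \<^bold>\<lless> z" "v2 \<Turnstile> A c2 \<^bold>\<and> c2 \<^bold>\<lless> z" using v2 up2 by (auto simp: forces_conj)
        show "goodc v2 (\<lambda>b. A b \<^bold>\<and> b \<^bold>\<lless> z)" by (intro goodc_intros A z vv2)
        fix v3 c assume v3: "v2 \<preceq> v3" "c \<in> elems v3" "v3 \<Turnstile> A c \<^bold>\<and> c \<^bold>\<lless> z" "v3 \<Turnstile> c1 \<^bold>\<sqsubseteq> c" "v3 \<Turnstile> c2 \<^bold>\<sqsubseteq> c"
        have vv3: "v \<preceq> v3" using vv2 v3 by (blast intro: extends_trans)
        note el3 = up2(5-)[THEN elems_mono[OF v3(1)]] elems_mono[OF v3(1) v2(2)] v3(2)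
        note up3 = up2(1-4)[THEN forces_mono[OF v3(1)]] v2(3-)[THEN forces_mono[OF v3(1)]]
        have below: "v3 \<Turnstile> b1 \<^bold>\<lless> c" "v3 \<Turnstile> b2 \<^bold>\<lless> c"
          using up3 el3 v3 po[OF vv3] poset_refl[OF po[OF vv3]] by (blast intro: way_below_mono)+
        show "v3 \<Turnstile> ?goal"
        proof (rule directedE[OF basisD(1)[OF ba A v3(2)], OF vv3 vv3 _ _ _ _ _ good_goal[OF vv3]])
          show "v3 \<Turnstile> A b1 \<^bold>\<and> b1 \<^bold>\<lless> c" "v3 \<Turnstile> A b2 \<^bold>\<and> b2 \<^bold>\<lless> c" using up3 below by (auto simp: forces_conj)
          show "goodc v3 (\<lambda>b. A b \<^bold>\<and> b \<^bold>\<lless> c)" by (intro goodc_intros A v3 vv3)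
          fix v4 b assume v4: "v3 \<preceq> v4" "b \<in> elems v4" "v4 \<Turnstile> A b \<^bold>\<and> b \<^bold>\<lless> c" "v4 \<Turnstile> b1 \<^bold>\<sqsubseteq> b" "v4 \<Turnstile> b2 \<^bold>\<sqsubseteq> b"
          have vv4: "v \<preceq> v4" using vv3 v4 by (blast intro: extends_trans)
          have "v4 \<Turnstile> ?T b"
            by (rule twice_belowI[of _ _ _ c])
              (use v4 A[OF vv4] z[OF vv4] forces_mono[OF v4(1) v3(3)] elems_mono[OF v4(1) v3(2)] in
                \<open>auto simp: forces_conj\<close>)
          with v4 show "v4 \<Turnstile> ?goal"
            by (intro forces_exI[OF _ goodc_goal[OF vv4]]) (auto simp only: forces_conj)
        qed (fact el3)+
      qed (fact v2 up2)+
    qed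
  qed
qed

text \<open>A bound \<open>t\<close> of the class is above every basis element way below
  \<open>c\<close>, for each basis element \<open>c \<lless> z\<close>; hence it is above each such
  \<open>c\<close>, as their supremum, and so above \<open>z\<close>.\<close>

lemma is_sup_twice_below:
  assumes "w \<Turnstile> poset" "w \<Turnstile> basis A" "goodc w A" "z \<in> elems w"
  shows "w \<Turnstile> is_sup z (\<lambda>b. A b \<^bold>\<and> (\<^bold>\<exists>c. (A c \<^bold>\<and> c \<^bold>\<lless> z) \<^bold>\<and> b \<^bold>\<lless> c))" (is "w \<Turnstile> is_sup z ?T")
proof (rule is_supI[OF goodc_twice_below[OF assms(3,4)] assms(4)])
  fix v b assume v: "w \<preceq> v" "b \<in> elems v" "v \<Turnstile> ?T b"
  note up = assms(1)[THEN forces_mono[OF v(1)]] goodc_mono[OF v(1) assms(3)] elems_mono[OF v(1) assms(4)]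
  show "v \<Turnstile> b \<^bold>\<sqsubseteq> z"
  proof (rule twice_belowE[OF v(3) up(2) v(2) up(3) good_le[OF v(2) up(3)]])
    fix u c assume u: "v \<preceq> u" "c \<in> elems u" "u \<Turnstile> c \<^bold>\<lless> z" "u \<Turnstile> b \<^bold>\<lless> c"
    show "u \<Turnstile> b \<^bold>\<sqsubseteq> z"
      using u up(1) v(2) up(3) by (blast intro: poset_trans way_below_imp_le forces_mono elems_mono)
  qed
next
  fix v t assume v: "w \<preceq> v" "t \<in> elems v" "v \<Turnstile> \<^bold>\<forall>b. ?T b \<^bold>\<longrightarrow> b \<^bold>\<sqsubseteq> t"
  note up = assms(2)[THEN forces_mono[OF v(1)]] goodc_mono[OF v(1) assms(3)] elems_mono[OF v(1) assms(4)]
  show "v \<Turnstile> z \<^bold>\<sqsubseteq> t"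
  proof (rule is_sup_least[OF basisD(2)[OF up] _ up(3) v(2)])
    show "goodc v (\<lambda>b. A b \<^bold>\<and> b \<^bold>\<lless> z)" by (intro goodc_intros up)
    fix v1 c assume v1: "v \<preceq> v1" "c \<in> elems v1" "v1 \<Turnstile> A c \<^bold>\<and> c \<^bold>\<lless> z"
    note up1 = up(1)[THEN forces_mono[OF v1(1)]] goodc_mono[OF v1(1) up(2)]
    note el1 = up(3)[THEN elems_mono[OF v1(1)]] elems_mono[OF v1(1) v(2)]
    show "v1 \<Turnstile> c \<^bold>\<sqsubseteq> t"
    proof (rule is_sup_least[OF basisD(2)[OF up1 v1(2)] _ v1(2) el1(2)])
      show "goodc v1 (\<lambda>b. A b \<^bold>\<and> b \<^bold>\<lless> c)" by (intro goodc_intros up1 v1)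
      fix v2 b assume v2: "v1 \<preceq> v2" "b \<in> elems v2" "v2 \<Turnstile> A b \<^bold>\<and> b \<^bold>\<lless> c"
      note up2 = goodc_mono[OF v2(1) up1(2)] el1[THEN elems_mono[OF v2(1)]] elems_mono[OF v2(1) v1(2)]
        forces_mono[OF v2(1) v1(3)]
      show "v2 \<Turnstile> b \<^bold>\<sqsubseteq> t"
      proof (rule forces_all_impD[OF forces_mono[OF extends_trans[OF v1(1) v2(1)] v(3)]])
        show "v2 \<Turnstile> ?T b" by (rule twice_belowI[of _ _ _ c]) (use v2 up2 in \<open>auto simp: forces_conj\<close>)
      qed (intro goodc_twice_below goodc_below up2 v2)+
    qed
  qed
qed

lemma interpolationE:
  assumes "w \<Turnstile> poset" "w \<Turnstile> basis A" "w \<Turnstile> y \<^bold>\<lless> z" "goodc w A" "y \<in> elems w" "z \<in> elems w" "good w q"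
    and "\<And>v b. w \<preceq> v \<Longrightarrow> b \<in> elems v \<Longrightarrow> v \<Turnstile> A b \<Longrightarrow> v \<Turnstile> y \<^bold>\<lless> b \<Longrightarrow> v \<Turnstile> b \<^bold>\<lless> z \<Longrightarrow> v \<Turnstile> q"
  shows "w \<Turnstile> q"
proof (rule way_belowE[OF assms(3) directed_twice_below[OF assms(1,2,4,6)]
      is_sup_twice_below[OF assms(1,2,4,6)] poset_refl[OF assms(1,6)] goodc_twice_below[OF assms(4,6)]
      assms(5,6,6,7)])
  fix v s assume v: "w \<preceq> v" "s \<in> elems v" "v \<Turnstile> A s \<^bold>\<and> (\<^bold>\<exists>c. (A c \<^bold>\<and> c \<^bold>\<lless> z) \<^bold>\<and> s \<^bold>\<lless> c)" "v \<Turnstile> y \<^bold>\<sqsubseteq> s"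
  show "v \<Turnstile> q"
  proof (rule twice_belowE[OF v(3) goodc_mono[OF v(1) assms(4)] v(2) elems_mono[OF v(1) assms(6)]
        good_mono[OF v(1) assms(7)]])
    fix u c assume u: "v \<preceq> u" "c \<in> elems u" "u \<Turnstile> A c" "u \<Turnstile> c \<^bold>\<lless> z" "u \<Turnstile> s \<^bold>\<lless> c"
    have wu: "w \<preceq> u" using v u by (blast intro: extends_trans)
    \<comment> \<open>The interpolant is \<open>c\<close>: for \<open>s\<close> only
      \<open>y \<sqsubseteq> s\<close> is at hand, and \<open>s \<lless> c\<close> strengthens this
      to \<open>y \<lless> c\<close>.\<close>
    have "u \<Turnstile> y \<^bold>\<lless> c"
      by (rule way_below_mono[OF forces_mono[OF wu assms(1)] forces_mono[OF u(1) v(4)] u(5) poset_refl])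
        (use u v wu assms(1,5) in \<open>auto intro: forces_mono elems_mono\<close>)
    with u wu show "u \<Turnstile> q" by (intro assms(8))
  qed
qed

section \<open>Compact elements as a basis\<close>

lemma forces_compact: "(w \<Turnstile> compact c) \<longleftrightarrow> (w \<Turnstile> c \<^bold>\<lless> c)"
  by (simp add: compact_def)

lemma compact_below:
  assumes "w \<Turnstile> poset" "w \<Turnstile> compact c" "c \<in> elems w" "x \<in> elems w"
  shows "(w \<Turnstile> c \<^bold>\<lless> x) \<longleftrightarrow> (w \<Turnstile> c \<^bold>\<sqsubseteq> x)"
  using assms way_below_mono[of w c c c x] poset_refl way_below_imp_le
  by (auto simp: forces_compact)

text \<open>By \<open>compact_below\<close> the class in the definition of algebraicity and the one
  in the definition of a basis agree in every extension, so directedness and the supremum carry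
  over.\<close>

lemma algebraic_imp_basis:
  assumes "w \<Turnstile> poset" "w \<Turnstile> algebraic"
  shows "w \<Turnstile> basis compact"
  unfolding basis_def
proof (rule forces_allI)
  show "goodc w (\<lambda>x. directed (\<lambda>b. compact b \<^bold>\<and> b \<^bold>\<lless> x) \<^bold>\<and> is_sup x (\<lambda>b. compact b \<^bold>\<and> b \<^bold>\<lless> x))"
    by (rule goodcI) (assumption | rule param | erule param_step)+
  have "goodc w (\<lambda>x. directed (\<lambda>b. compact b \<^bold>\<and> b \<^bold>\<sqsubseteq> x) \<^bold>\<and> is_sup x (\<lambda>b. compact b \<^bold>\<and> b \<^bold>\<sqsubseteq> x))"
    by (rule goodcI) (assumption | rule param | erule param_step)+
  note alg = forces_allD[OF forces_mono[OF _ assms(2), unfolded algebraic_def] goodc_mono[OF _ this],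
      unfolded forces_conj]
  fix v x assume v: "w \<preceq> v" "x \<in> elems v"
  have eq: "(u \<Turnstile> compact b \<^bold>\<and> b \<^bold>\<sqsubseteq> x) \<longleftrightarrow> (u \<Turnstile> compact b \<^bold>\<and> b \<^bold>\<lless> x)" if "v \<preceq> u" "b \<in> elems u" for u b
    using compact_below[of u b x] forces_mono[OF extends_trans[OF v(1) that(1)] assms(1)]
      elems_mono[OF that(1) v(2)] that(2) by (auto simp: forces_conj)
  show "v \<Turnstile> directed (\<lambda>b. compact b \<^bold>\<and> b \<^bold>\<lless> x) \<^bold>\<and> is_sup x (\<lambda>b. compact b \<^bold>\<and> b \<^bold>\<lless> x)"
    unfolding forces_conj
  proof
    show "v \<Turnstile> directed (\<lambda>b. compact b \<^bold>\<and> b \<^bold>\<lless> x)"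
      by (rule directed_cong[OF conjunct1[OF alg[OF v(1) v(1) v(2)]] _ _ eq]) (intro goodc_intros v)+
    show "v \<Turnstile> is_sup x (\<lambda>b. compact b \<^bold>\<and> b \<^bold>\<lless> x)"
      by (rule is_sup_cong[OF conjunct2[OF alg[OF v(1) v(1) v(2)]] _ _ v(2) eq]) (intro goodc_intros v)+
  qed
qed

section \<open>Sharpness from decidability\<close>

lemma goodc_sharp_body:
  "x \<in> elems w \<Longrightarrow> goodc w (\<lambda>y. \<^bold>\<forall>z. y \<^bold>\<lless> z \<^bold>\<longrightarrow> (y \<^bold>\<lless> x \<^bold>\<or> \<^bold>\<not> (z \<^bold>\<sqsubseteq> x)))"
  "x \<in> elems w \<Longrightarrow> y \<in> elems w \<Longrightarrow> goodc w (\<lambda>z. y \<^bold>\<lless> x \<^bold>\<or> \<^bold>\<not> (z \<^bold>\<sqsubseteq> x))"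
  by (rule goodcI, (assumption | rule param | erule param_step)+)+

lemma sharpI:
  assumes "x \<in> elems w"
    and "\<And>v y z. w \<preceq> v \<Longrightarrow> y \<in> elems v \<Longrightarrow> z \<in> elems v \<Longrightarrow> v \<Turnstile> y \<^bold>\<lless> z \<Longrightarrow>
      v \<Turnstile> y \<^bold>\<lless> x \<^bold>\<or> \<^bold>\<not> (z \<^bold>\<sqsubseteq> x)"
  shows "w \<Turnstile> sharp x"
  unfolding sharp_def
proof (rule forces_allI[OF goodc_sharp_body(1)[OF assms(1)]])
  fix v y assume v: "w \<preceq> v" "y \<in> elems v"
  show "v \<Turnstile> \<^bold>\<forall>z. y \<^bold>\<lless> z \<^bold>\<longrightarrow> (y \<^bold>\<lless> x \<^bold>\<or> \<^bold>\<not> (z \<^bold>\<sqsubseteq> x))"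
    by (rule forces_all_impI[OF goodc_way_above goodc_sharp_body(2)])
      (use v assms in \<open>auto intro: extends_trans elems_mono\<close>)
qed

lemma sharpD:
  assumes "w \<Turnstile> sharp x" "w \<Turnstile> y \<^bold>\<lless> z" "x \<in> elems w" "y \<in> elems w" "z \<in> elems w"
  shows "w \<Turnstile> y \<^bold>\<lless> x \<^bold>\<or> \<^bold>\<not> (z \<^bold>\<sqsubseteq> x)"
  using forces_allD[OF assms(1)[unfolded sharp_def] goodc_sharp_body(1)[OF assms(3)] assms(4)] assms(2)
  by (rule forces_all_impD) (intro goodc_intros goodc_sharp_body assms)+

text \<open>The core shared by the three sufficient conditions. In use, \<open>p\<close> is the
  decided proposition about an interpolant; it sits between \<open>z \<sqsubseteq> x\<close> and
  \<open>y \<lless> x\<close>, so a positive answer gives the left disjunct and a negative one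
  refutes \<open>z \<sqsubseteq> x\<close>.\<close>

lemma sharp_stepI:
  assumes "w \<Turnstile> decidable p" "x \<in> elems w" "y \<in> elems w" "z \<in> elems w"
    and "\<And>v. w \<preceq> v \<Longrightarrow> v \<Turnstile> p \<Longrightarrow> v \<Turnstile> y \<^bold>\<lless> x" "\<And>v. w \<preceq> v \<Longrightarrow> v \<Turnstile> z \<^bold>\<sqsubseteq> x \<Longrightarrow> v \<Turnstile> p"
  shows "w \<Turnstile> y \<^bold>\<lless> x \<^bold>\<or> \<^bold>\<not> (z \<^bold>\<sqsubseteq> x)"
  using assms(1)[unfolded decidable_def]
proof (rule forces_disjE)
  show "good w (y \<^bold>\<lless> x \<^bold>\<or> \<^bold>\<not> (z \<^bold>\<sqsubseteq> x))" by (intro good_intros assms)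
  fix v assume v: "w \<preceq> v"
  note el = assms(2-4)[THEN elems_mono[OF v]]
  show "v \<Turnstile> y \<^bold>\<lless> x \<^bold>\<or> \<^bold>\<not> (z \<^bold>\<sqsubseteq> x)" if "v \<Turnstile> p"
    by (rule forces_disjI1[OF assms(5)[OF v that]]) (intro good_intros el)
  assume np: "v \<Turnstile> \<^bold>\<not> p"
  have "v \<Turnstile> \<^bold>\<not> (z \<^bold>\<sqsubseteq> x)"
  proof (rule forces_notI)
    fix u assume u: "v \<preceq> u" "u \<Turnstile> z \<^bold>\<sqsubseteq> x"
    with v have "u \<Turnstile> p" by (blast intro: assms(6) extends_trans)
    with forces_mono[OF u(1) np] show "u \<Turnstile> falsity" by (rule forces_notE) (rule good_falsity)
  qed (intro good_intros el)
  then show "v \<Turnstile> y \<^bold>\<lless> x \<^bold>\<or> \<^bold>\<not> (z \<^bold>\<sqsubseteq> x)" by (rule forces_disjI2) (intro good_intros el)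
qed

text \<open>A directed set is inhabited, and any of its members is above \<open>p\<close>.\<close>

lemma bottom_way_below:
  assumes "w \<Turnstile> is_bottom p" "p \<in> elems w" "x \<in> elems w"
  shows "w \<Turnstile> p \<^bold>\<lless> x"
proof (rule way_belowI[OF assms(2,3)])
  fix v S u assume v: "w \<preceq> v" "S \<in> subsets v" "v \<Turnstile> directed (cls S)"
  have good: "goodc t (\<lambda>s. s \<^bold>\<in> S \<^bold>\<and> p \<^bold>\<sqsubseteq> s)" if "v \<preceq> t" for t
    using that v assms(2) by (auto intro!: goodc_intros intro: subsets_mono elems_mono extends_trans)
  show "v \<Turnstile> \<^bold>\<exists>s. s \<^bold>\<in> S \<^bold>\<and> p \<^bold>\<sqsubseteq> s"
  proof (rule directedE_inh[OF v(3) goodc_cls[OF v(2)] good_ex[OF good[OF extends_refl]]])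
    fix t s assume t: "v \<preceq> t" "s \<in> elems t" "t \<Turnstile> s \<^bold>\<in> S"
    have wt: "w \<preceq> t" using v t by (blast intro: extends_trans)
    have "t \<Turnstile> p \<^bold>\<sqsubseteq> s"
      using forces_mono[OF wt assms(1)] elems_mono[OF wt assms(2)] t(2)
      unfolding is_bottom_def by (auto intro: forces_allD goodc_above)
    with t show "t \<Turnstile> \<^bold>\<exists>s. s \<^bold>\<in> S \<^bold>\<and> p \<^bold>\<sqsubseteq> s"
      by (intro forces_exI[OF _ good[OF t(1)] t(2)]) (auto simp: forces_conj)
  qed
qed

lemma bottom_le: "w \<Turnstile> poset \<Longrightarrow> w \<Turnstile> is_bottom p \<Longrightarrow> p \<in> elems w \<Longrightarrow> x \<in> elems w \<Longrightarrow> w \<Turnstile> p \<^bold>\<sqsubseteq> x"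
  by (intro way_below_imp_le bottom_way_below)

text \<open>The decided proposition is \<open>b = p\<close> for an interpolant \<open>b\<close>
  between \<open>y\<close> and \<open>z\<close>. It gives
  \<open>y \<lless> b \<sqsubseteq> p\<close>; conversely \<open>z \<sqsubseteq> p\<close> gives
  \<open>b \<sqsubseteq> p\<close>, hence \<open>b = p\<close> by leastness and
  antisymmetry.\<close>

lemma bottom_sharp:
  assumes "w \<Turnstile> poset" "w \<Turnstile> basis A" "goodc w A" "p \<in> elems w" "w \<Turnstile> is_bottom p"
    and dec: "w \<Turnstile> \<^bold>\<forall>b. A b \<^bold>\<longrightarrow> decidable (b \<^bold>= p)"
  shows "w \<Turnstile> sharp p"
proof (rule sharpI[OF assms(4)])
  fix v y z assume v: "w \<preceq> v" "y \<in> elems v" "z \<in> elems v" "v \<Turnstile> y \<^bold>\<lless> z"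
  note up = assms(1,2)[THEN forces_mono[OF v(1)]] goodc_mono[OF v(1) assms(3)] elems_mono[OF v(1) assms(4)]
  show "v \<Turnstile> y \<^bold>\<lless> p \<^bold>\<or> \<^bold>\<not> (z \<^bold>\<sqsubseteq> p)"
  proof (rule interpolationE[OF up(1,2) v(4) up(3) v(2,3)])
    show "good v (y \<^bold>\<lless> p \<^bold>\<or> \<^bold>\<not> (z \<^bold>\<sqsubseteq> p))" by (intro good_intros up v)
    fix u b assume u: "v \<preceq> u" "b \<in> elems u" "u \<Turnstile> A b" "u \<Turnstile> y \<^bold>\<lless> b" "u \<Turnstile> b \<^bold>\<lless> z"
    have wu: "w \<preceq> u" using v u by (blast intro: extends_trans)
    have el: "y \<in> elems u" "z \<in> elems u" "p \<in> elems u" using u(1) v(2,3) up(4) by (auto intro: elems_mono)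
    have "goodc u (\<lambda>b. decidable (b \<^bold>= p))"
      by (rule goodcI) (insert el(3), (assumption | rule param | erule param_step)+)
    then have "u \<Turnstile> decidable (b \<^bold>= p)"
      by (intro forces_all_impD[OF forces_mono[OF wu dec] u(3) goodc_mono[OF wu assms(3)] _ u(2)])
    then show "u \<Turnstile> y \<^bold>\<lless> p \<^bold>\<or> \<^bold>\<not> (z \<^bold>\<sqsubseteq> p)"
      using el(3,1,2)
    proof (rule sharp_stepI)
      fix t assume t: "u \<preceq> t"
      have wt: "w \<preceq> t" using wu t by (rule extends_trans)
      note po = forces_mono[OF wt assms(1)] and bo = forces_mono[OF wt assms(5)]
      note el = el[THEN elems_mono[OF t]] elems_mono[OF t u(2)]
      note b = u(3-)[THEN forces_mono[OF t]]
      show "t \<Turnstile> y \<^bold>\<lless> p" if "t \<Turnstile> b \<^bold>= p"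
        using way_below_mono[OF po poset_refl[OF po] b(2) eq_imp_le[OF po that]] el by blast
      show "t \<Turnstile> b \<^bold>= p" if "t \<Turnstile> z \<^bold>\<sqsubseteq> p"
        using poset_trans[OF po way_below_imp_le[OF po b(3)] that] el po
        by (blast intro: poset_antisym bottom_le[OF po bo])
    qed
  qed
qed

lemma goodc_decidable_way_below:
  "goodc w A \<Longrightarrow> goodc w (\<lambda>a. \<^bold>\<forall>b. A a \<^bold>\<longrightarrow> A b \<^bold>\<longrightarrow> decidable (a \<^bold>\<lless> b))"
  by (rule goodcI, drule (1) goodcD) (assumption | rule param | erule param_step)+

lemma goodc_decidable_le:
  "goodc w A \<Longrightarrow> goodc w (\<lambda>a. \<^bold>\<forall>b. A a \<^bold>\<longrightarrow> A b \<^bold>\<longrightarrow> decidable (a \<^bold>\<sqsubseteq> b))"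
  by (rule goodcI, drule (1) goodcD) (assumption | rule param | erule param_step)+

lemma goodc_decidable:
  "x \<in> elems w \<Longrightarrow> goodc w (\<lambda>y. decidable (x \<^bold>\<lless> y))"
  "x \<in> elems w \<Longrightarrow> goodc w (\<lambda>y. decidable (x \<^bold>\<sqsubseteq> y))"
  "x \<in> elems w \<Longrightarrow> goodc w (\<lambda>y. decidable (y \<^bold>= x))"
  by (rule goodcI, (assumption | rule param | erule param_step)+)+

text \<open>The class \<open>A\<close> is arbitrary so that the lemma serves both the given basis
  and, for algebraic dcpos, the compact elements. The interpolant \<open>b\<close> and the element
  \<open>x\<close> both lie in \<open>A\<close>, so the hypothesis decides a relation between
  them.\<close>

lemma decidable_imp_sharp:
  assumes "w \<Turnstile> poset" "w \<Turnstile> basis A" "goodc w A"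
    and dec: "w \<Turnstile> (\<^bold>\<forall>a. \<^bold>\<forall>b. A a \<^bold>\<longrightarrow> A b \<^bold>\<longrightarrow> decidable (a \<^bold>\<lless> b))
      \<^bold>\<or> (\<^bold>\<forall>a. \<^bold>\<forall>b. A a \<^bold>\<longrightarrow> A b \<^bold>\<longrightarrow> decidable (a \<^bold>\<sqsubseteq> b))"
  shows "w \<Turnstile> \<^bold>\<forall>a. A a \<^bold>\<longrightarrow> sharp a"
proof (rule forces_all_impI[OF assms(3) goodc_sharp])
  fix w' x assume w': "w \<preceq> w'" "x \<in> elems w'" "w' \<Turnstile> A x"
  show "w' \<Turnstile> sharp x"
  proof (rule sharpI[OF w'(2)])
    fix v y z assume v: "w' \<preceq> v" "y \<in> elems v" "z \<in> elems v" "v \<Turnstile> y \<^bold>\<lless> z"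
    have wv: "w \<preceq> v" using w' v by (blast intro: extends_trans)
    note up = assms(1,2)[THEN forces_mono[OF wv]] goodc_mono[OF wv assms(3)] elems_mono[OF v(1) w'(2)]
    show "v \<Turnstile> y \<^bold>\<lless> x \<^bold>\<or> \<^bold>\<not> (z \<^bold>\<sqsubseteq> x)"
    proof (rule interpolationE[OF up(1,2) v(4) up(3) v(2,3)])
      show "good v (y \<^bold>\<lless> x \<^bold>\<or> \<^bold>\<not> (z \<^bold>\<sqsubseteq> x))" by (intro good_intros up v)
      fix u b assume u: "v \<preceq> u" "b \<in> elems u" "u \<Turnstile> A b" "u \<Turnstile> y \<^bold>\<lless> b" "u \<Turnstile> b \<^bold>\<lless> z"
      have wu: "w \<preceq> u" using wv u by (blast intro: extends_trans)
      have el: "y \<in> elems u" "z \<in> elems u" "x \<in> elems u" using u(1) v(2,3) up(4) by (auto intro: elems_mono)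
      have Ax: "u \<Turnstile> A x" using forces_mono[OF extends_trans[OF v(1) u(1)] w'(3)] .
      show "u \<Turnstile> y \<^bold>\<lless> x \<^bold>\<or> \<^bold>\<not> (z \<^bold>\<sqsubseteq> x)"
      proof (rule forces_disjE[OF forces_mono[OF wu dec]])
        show "good u (y \<^bold>\<lless> x \<^bold>\<or> \<^bold>\<not> (z \<^bold>\<sqsubseteq> x))" by (intro good_intros el)
        fix t assume t: "u \<preceq> t"
        have wt: "w \<preceq> t" using wu t by (rule extends_trans)
        note elt = el[THEN elems_mono[OF t]] elems_mono[OF t u(2)]
        note b = u(3-)[THEN forces_mono[OF t]] forces_mono[OF t Ax]
        \<comment> \<open>The next three facts form the chain from \<open>z \<sqsubseteq> x\<close>
          to \<open>b \<lless> x\<close> to \<open>b \<sqsubseteq> x\<close> to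
          \<open>y \<lless> x\<close>. Either middle proposition can therefore be the one
          decided.\<close>
        have step: "s \<Turnstile> y \<^bold>\<lless> x" if "t \<preceq> s" "s \<Turnstile> b \<^bold>\<sqsubseteq> x" for s
          using way_below_mono[OF _ poset_refl forces_mono[OF that(1) b(2)] that(2)] elt[THEN elems_mono[OF that(1)]]
            forces_mono[OF extends_trans[OF wt that(1)] assms(1)] by blast
        have below: "s \<Turnstile> b \<^bold>\<lless> x" if "t \<preceq> s" "s \<Turnstile> z \<^bold>\<sqsubseteq> x" for s
          using way_below_mono[OF _ poset_refl forces_mono[OF that(1) b(3)] that(2)] elt[THEN elems_mono[OF that(1)]]
            forces_mono[OF extends_trans[OF wt that(1)] assms(1)] by blast
        have le: "s \<Turnstile> b \<^bold>\<sqsubseteq> x" if "t \<preceq> s" "s \<Turnstile> b \<^bold>\<lless> x" for s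
          using way_below_imp_le[OF _ that(2)] elt[THEN elems_mono[OF that(1)]]
            forces_mono[OF extends_trans[OF wt that(1)] assms(1)] by blast
        {
          assume "t \<Turnstile> \<^bold>\<forall>a. \<^bold>\<forall>b. A a \<^bold>\<longrightarrow> A b \<^bold>\<longrightarrow> decidable (a \<^bold>\<lless> b)"
          from forces_all_all_impD[OF this b(1,4)]
          have "t \<Turnstile> decidable (b \<^bold>\<lless> x)"
            by (auto intro!: goodc_decidable_way_below goodc_decidable goodc_mono[OF wt assms(3)] elt)
          then show "t \<Turnstile> y \<^bold>\<lless> x \<^bold>\<or> \<^bold>\<not> (z \<^bold>\<sqsubseteq> x)"
            by (rule sharp_stepI) (use elt step below le in blast)+
        }
        {
          assume "t \<Turnstile> \<^bold>\<forall>a. \<^bold>\<forall>b. A a \<^bold>\<longrightarrow> A b \<^bold>\<longrightarrow> decidable (a \<^bold>\<sqsubseteq> b)"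
          from forces_all_all_impD[OF this b(1,4)]
          have "t \<Turnstile> decidable (b \<^bold>\<sqsubseteq> x)"
            by (auto intro!: goodc_decidable_le goodc_decidable goodc_mono[OF wt assms(3)] elt)
          then show "t \<Turnstile> y \<^bold>\<lless> x \<^bold>\<or> \<^bold>\<not> (z \<^bold>\<sqsubseteq> x)"
            by (rule sharp_stepI) (use elt step below le in blast)+
        }
      qed
    qed
  qed
qed

section \<open>Scott density of the sharp elements\<close>

lemma scott_closedD:
  assumes "w \<Turnstile> scott_closed (cls C)" "C \<in> subsets w" "w \<Turnstile> directed (cls S)" "S \<in> subsets w"
    "w \<Turnstile> cls S \<^bold>\<subseteq> cls C" "w \<Turnstile> is_sup u (cls S)" "u \<in> elems w"
  shows "w \<Turnstile> u \<^bold>\<in> C"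
proof -
  have *: "w \<Turnstile> \<^bold>\<forall>\<^sub>2S. directed (cls S) \<^bold>\<longrightarrow> cls S \<^bold>\<subseteq> cls C \<^bold>\<longrightarrow> (\<^bold>\<forall>u. is_sup u (cls S) \<^bold>\<longrightarrow> u \<^bold>\<in> C)"
    using assms(1) unfolding scott_closed_def forces_conj by blast
  have "goodc2 w (\<lambda>S. directed (cls S) \<^bold>\<longrightarrow> cls S \<^bold>\<subseteq> cls C \<^bold>\<longrightarrow> (\<^bold>\<forall>u. is_sup u (cls S) \<^bold>\<longrightarrow> u \<^bold>\<in> C))"
    by (rule goodc2I) (insert assms(2), (assumption | rule param | erule param_step)+)
  from forces_impD[OF forces_impD[OF forces_all2D[OF * this assms(4)] assms(3)] assms(5)]
  have "w \<Turnstile> \<^bold>\<forall>u. is_sup u (cls S) \<^bold>\<longrightarrow> u \<^bold>\<in> C" .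
  moreover have "goodc w (\<lambda>u. is_sup u (cls S))"
    by (rule goodcI) (insert assms(4), (assumption | rule param | erule param_step)+)
  ultimately show ?thesis
    using assms(2,6,7)
    by (intro forces_all_impD[where A = "\<lambda>u. is_sup u (cls S)" and C = "cls C"] goodc_cls)
qed

lemma scott_openD:
  assumes "w \<Turnstile> scott_open (cls U)" "U \<in> subsets w" "w \<Turnstile> directed (cls S)" "S \<in> subsets w"
    "w \<Turnstile> is_sup u (cls S)" "w \<Turnstile> u \<^bold>\<in> U" "u \<in> elems w"
  shows "w \<Turnstile> \<^bold>\<exists>s. s \<^bold>\<in> S \<^bold>\<and> s \<^bold>\<in> U"
proof -
  let ?ex = "\<^bold>\<exists>s. s \<^bold>\<in> S \<^bold>\<and> s \<^bold>\<in> U"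
  have *: "w \<Turnstile> \<^bold>\<forall>\<^sub>2S. directed (cls S) \<^bold>\<longrightarrow>
      (\<^bold>\<forall>u. is_sup u (cls S) \<^bold>\<longrightarrow> u \<^bold>\<in> U \<^bold>\<longrightarrow> (\<^bold>\<exists>s. s \<^bold>\<in> S \<^bold>\<and> s \<^bold>\<in> U))"
    using assms(1) unfolding scott_open_def forces_conj by blast
  have "goodc2 w (\<lambda>S. directed (cls S) \<^bold>\<longrightarrow>
      (\<^bold>\<forall>u. is_sup u (cls S) \<^bold>\<longrightarrow> u \<^bold>\<in> U \<^bold>\<longrightarrow> (\<^bold>\<exists>s. s \<^bold>\<in> S \<^bold>\<and> s \<^bold>\<in> U)))"
    by (rule goodc2I) (insert assms(2), (assumption | rule param | erule param_step)+)
  from forces_impD[OF forces_all2D[OF * this assms(4)] assms(3)]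
  have "w \<Turnstile> \<^bold>\<forall>u. is_sup u (cls S) \<^bold>\<longrightarrow> u \<^bold>\<in> U \<^bold>\<longrightarrow> ?ex" .
  moreover have "goodc w (\<lambda>u. is_sup u (cls S))" "goodc w (\<lambda>u. u \<^bold>\<in> U \<^bold>\<longrightarrow> ?ex)"
    by ((rule goodcI, insert assms(2,4), (assumption | rule param | erule param_step)+)+)
  ultimately have "w \<Turnstile> u \<^bold>\<in> U \<^bold>\<longrightarrow> ?ex"
    using assms(5,7) by (intro forces_all_impD[where C = "\<lambda>u. u \<^bold>\<in> U \<^bold>\<longrightarrow> ?ex"])
  then show ?thesis using assms(6) by (rule forces_impD)
qed

text \<open>\<open>x\<close> is the directed supremum of the basis elements way below it, and these
  all lie in \<open>C\<close>.\<close>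

lemma basis_dense:
  assumes "w \<Turnstile> basis A" "goodc w A" "w \<Turnstile> scott_closed (cls C)" "C \<in> subsets w"
    "w \<Turnstile> \<^bold>\<forall>a. A a \<^bold>\<longrightarrow> a \<^bold>\<in> C" "x \<in> elems w"
  shows "w \<Turnstile> x \<^bold>\<in> C"
proof (rule directed_supE[OF basisD[OF assms(1,2,6)] _ assms(6) good_mem[OF assms(6,4)]])
  show "goodc w (\<lambda>b. A b \<^bold>\<and> b \<^bold>\<lless> x)" by (intro goodc_intros assms)
  fix v S assume v: "w \<preceq> v" "S \<in> subsets v" "v \<Turnstile> directed (cls S)" "v \<Turnstile> is_sup x (cls S)"
    and eq: "\<And>t b. v \<preceq> t \<Longrightarrow> b \<in> elems t \<Longrightarrow> (t \<Turnstile> b \<^bold>\<in> S) \<longleftrightarrow> (t \<Turnstile> A b \<^bold>\<and> b \<^bold>\<lless> x)"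
  note C = subsets_mono[OF v(1) assms(4)]
  have "v \<Turnstile> cls S \<^bold>\<subseteq> cls C"
    unfolding included_def
  proof (rule forces_all_impI[OF goodc_cls[OF v(2)] goodc_cls[OF C]])
    fix u b assume u: "v \<preceq> u" "b \<in> elems u" "u \<Turnstile> b \<^bold>\<in> S"
    have wu: "w \<preceq> u" using v u by (blast intro: extends_trans)
    have "u \<Turnstile> A b" using eq u by (auto simp: forces_conj)
    from forces_all_impD[OF forces_mono[OF wu assms(5)] this goodc_mono[OF wu assms(2)]
        goodc_cls[OF subsets_mono[OF wu assms(4)]] u(2)]
    show "u \<Turnstile> b \<^bold>\<in> C" .
  qed
  then show "v \<Turnstile> x \<^bold>\<in> C"
    using scott_closedD[OF forces_mono[OF v(1) assms(3)] C v(3,2)] v(4) elems_mono[OF v(1) assms(6)] by blast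
qed

text \<open>A point \<open>x\<close> of \<open>U\<close> is the directed supremum of the basis
  elements way below it; inaccessibility puts one of these in \<open>U\<close>, and it is sharp by
  assumption.\<close>

lemma basis_meets_open:
  assumes "w \<Turnstile> basis A" "goodc w A" "w \<Turnstile> scott_open (cls U)" "U \<in> subsets w" "w \<Turnstile> inhabited (cls U)"
    and sharp: "w \<Turnstile> \<^bold>\<forall>a. A a \<^bold>\<longrightarrow> sharp a"
  shows "w \<Turnstile> \<^bold>\<exists>x. x \<^bold>\<in> U \<^bold>\<and> sharp x"
proof (rule forces_exE[OF assms(5)[unfolded inhabited_def] goodc_cls[OF assms(4)]])
  have good: "goodc v (\<lambda>x. x \<^bold>\<in> U \<^bold>\<and> sharp x)" if "w \<preceq> v" for v
    using subsets_mono[OF that assms(4)] by (intro goodc_intros)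
  show "good w (\<^bold>\<exists>x. x \<^bold>\<in> U \<^bold>\<and> sharp x)" by (intro good_ex good extends_refl)
  fix v x assume v: "w \<preceq> v" "x \<in> elems v" "v \<Turnstile> x \<^bold>\<in> U"
  note A = goodc_mono[OF v(1) assms(2)]
  show "v \<Turnstile> \<^bold>\<exists>x. x \<^bold>\<in> U \<^bold>\<and> sharp x"
  proof (rule directed_supE[OF basisD[OF forces_mono[OF v(1) assms(1)] A v(2)] _ v(2) good_ex[OF good[OF v(1)]]])
    show "goodc v (\<lambda>b. A b \<^bold>\<and> b \<^bold>\<lless> x)" by (intro goodc_intros A v)
    fix u S assume u: "v \<preceq> u" "S \<in> subsets u" "u \<Turnstile> directed (cls S)" "u \<Turnstile> is_sup x (cls S)"
      and eq: "\<And>t b. u \<preceq> t \<Longrightarrow> b \<in> elems t \<Longrightarrow> (t \<Turnstile> b \<^bold>\<in> S) \<longleftrightarrow> (t \<Turnstile> A b \<^bold>\<and> b \<^bold>\<lless> x)"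
    have wu: "w \<preceq> u" using v u by (blast intro: extends_trans)
    note U = subsets_mono[OF wu assms(4)]
    show "u \<Turnstile> \<^bold>\<exists>x. x \<^bold>\<in> U \<^bold>\<and> sharp x"
    proof (rule forces_exE[OF scott_openD[OF forces_mono[OF wu assms(3)] U u(3,2,4) forces_mono[OF u(1) v(3)]
            elems_mono[OF u(1) v(2)]] _ good_ex[OF good[OF wu]]])
      show "goodc u (\<lambda>s. s \<^bold>\<in> S \<^bold>\<and> s \<^bold>\<in> U)" by (intro goodc_intros U u)
      fix t s assume t: "u \<preceq> t" "s \<in> elems t" "t \<Turnstile> s \<^bold>\<in> S \<^bold>\<and> s \<^bold>\<in> U"
      have wt: "w \<preceq> t" using wu t by (blast intro: extends_trans)
      have "t \<Turnstile> A s" using eq t by (auto simp: forces_conj)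
      from forces_all_impD[OF forces_mono[OF wt sharp] this goodc_mono[OF wt assms(2)] goodc_sharp t(2)]
      show "t \<Turnstile> \<^bold>\<exists>x. x \<^bold>\<in> U \<^bold>\<and> sharp x"
        by (intro forces_exI[OF _ good[OF wt] t(2)]) (use t in \<open>auto simp: forces_conj\<close>)
    qed
  qed
qed

lemma goodc_lower:
  "C \<in> subsets w \<Longrightarrow> goodc w (\<lambda>x. \<^bold>\<forall>y. y \<^bold>\<in> C \<^bold>\<longrightarrow> x \<^bold>\<sqsubseteq> y \<^bold>\<longrightarrow> x \<^bold>\<in> C)"
  by (rule goodcI) (assumption | rule param | erule param_step)+

lemma scott_closed_univ:
  assumes "C \<in> subsets w" and all: "\<And>v x. w \<preceq> v \<Longrightarrow> x \<in> elems v \<Longrightarrow> v \<Turnstile> x \<^bold>\<in> C"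
  shows "w \<Turnstile> scott_closed (cls C)"
  unfolding scott_closed_def forces_conj
proof
  show "w \<Turnstile> \<^bold>\<forall>x. \<^bold>\<forall>y. y \<^bold>\<in> C \<^bold>\<longrightarrow> x \<^bold>\<sqsubseteq> y \<^bold>\<longrightarrow> x \<^bold>\<in> C"
  proof (rule forces_allI[OF goodc_lower[OF assms(1)]])
    fix v x assume v: "w \<preceq> v" "x \<in> elems v"
    have good: "goodc v (\<lambda>y. x \<^bold>\<sqsubseteq> y \<^bold>\<longrightarrow> x \<^bold>\<in> C)"
      using v subsets_mono[OF v(1) assms(1)] by (intro goodc_imp goodc_const good_mem goodc_above)
    show "v \<Turnstile> \<^bold>\<forall>y. y \<^bold>\<in> C \<^bold>\<longrightarrow> x \<^bold>\<sqsubseteq> y \<^bold>\<longrightarrow> x \<^bold>\<in> C"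
    proof (rule forces_all_impI[OF goodc_cls[OF subsets_mono[OF v(1) assms(1)]] good], rule forces_impI)
      fix u y t assume "v \<preceq> u" "y \<in> elems u" "u \<preceq> t"
      then show "t \<Turnstile> x \<^bold>\<in> C" using v by (blast intro: all extends_trans elems_mono)
    qed (use v assms(1) in \<open>blast intro: good_le good_mem elems_mono subsets_mono\<close>)+
  qed
  show "w \<Turnstile> \<^bold>\<forall>\<^sub>2S. directed (cls S) \<^bold>\<longrightarrow> cls S \<^bold>\<subseteq> cls C \<^bold>\<longrightarrow> (\<^bold>\<forall>u. is_sup u (cls S) \<^bold>\<longrightarrow> u \<^bold>\<in> C)"
  proof (rule forces_all2I)
    show "goodc2 w (\<lambda>S. directed (cls S) \<^bold>\<longrightarrow> cls S \<^bold>\<subseteq> cls C \<^bold>\<longrightarrow> (\<^bold>\<forall>u. is_sup u (cls S) \<^bold>\<longrightarrow> u \<^bold>\<in> C))"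
      by (rule goodc2I) (insert assms(1), (assumption | rule param | erule param_step)+)
    fix v S assume v: "w \<preceq> v" "S \<in> subsets v"
    note C = subsets_mono[OF v(1) assms(1)]
    have good: "goodc v (\<lambda>u. is_sup u (cls S))"
      "good v (\<^bold>\<forall>u. is_sup u (cls S) \<^bold>\<longrightarrow> u \<^bold>\<in> C)" "good v (cls S \<^bold>\<subseteq> cls C)"
      by ((rule goodcI goodI, insert C v(2), (assumption | rule param | erule param_step)+)+)
    show "v \<Turnstile> directed (cls S) \<^bold>\<longrightarrow> cls S \<^bold>\<subseteq> cls C \<^bold>\<longrightarrow> (\<^bold>\<forall>u. is_sup u (cls S) \<^bold>\<longrightarrow> u \<^bold>\<in> C)"
    proof (intro forces_impI good_imp good good_directed goodc_cls v(2))
      fix v1 assume v1: "v \<preceq> v1"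
      show "good v1 (cls S \<^bold>\<subseteq> cls C)" "good v1 (\<^bold>\<forall>u. is_sup u (cls S) \<^bold>\<longrightarrow> u \<^bold>\<in> C)"
        using good v1 by (blast intro: good_mono)+
      fix v2 assume v2: "v1 \<preceq> v2"
      have wv2: "w \<preceq> v2" "v \<preceq> v2" using v v1 v2 by (blast intro: extends_trans)+
      show "v2 \<Turnstile> \<^bold>\<forall>u. is_sup u (cls S) \<^bold>\<longrightarrow> u \<^bold>\<in> C"
        by (rule forces_all_impI[OF goodc_mono[OF wv2(2) good(1)] goodc_cls[OF subsets_mono[OF wv2(1) assms(1)]]])
          (use wv2 in \<open>blast intro: all extends_trans\<close>)
    qed
  qed
qed

lemma sharp_closure:
  assumes "w \<Turnstile> poset" "w \<Turnstile> basis A" "goodc w A" and sharp: "w \<Turnstile> \<^bold>\<forall>a. A a \<^bold>\<longrightarrow> sharp a"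
  shows "w \<Turnstile> \<^bold>\<exists>\<^sub>2C. is_scott_closure (cls C) sharp \<^bold>\<and> (\<^bold>\<forall>x. x \<^bold>\<in> C)"
\<comment> \<open>Reflexivity is the property that defines the subset of all elements; the closure
  is exhibited as this subset.\<close>
proof (rule comprehensionE[OF goodc_refl])
  have good: "goodc2 v (\<lambda>C. is_scott_closure (cls C) sharp \<^bold>\<and> (\<^bold>\<forall>x. x \<^bold>\<in> C))" for v
    by (rule goodc2I) (assumption | rule param | erule param_step)+
  show "good w (\<^bold>\<exists>\<^sub>2C. is_scott_closure (cls C) sharp \<^bold>\<and> (\<^bold>\<forall>x. x \<^bold>\<in> C))" by (intro good_ex2 good)
  fix v C assume v: "w \<preceq> v" "C \<in> subsets v"
    and "\<And>u x. v \<preceq> u \<Longrightarrow> x \<in> elems u \<Longrightarrow> (u \<Turnstile> x \<^bold>\<in> C) \<longleftrightarrow> (u \<Turnstile> x \<^bold>\<sqsubseteq> x)"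
  then have all: "u \<Turnstile> x \<^bold>\<in> C" if "v \<preceq> u" "x \<in> elems u" for u x
    using that assms(1) by (auto intro: poset_refl forces_mono extends_trans)
  have "v \<Turnstile> is_scott_closure (cls C) sharp"
    unfolding is_scott_closure_def forces_conj
  proof (intro conjI)
    show "v \<Turnstile> scott_closed (cls C)" using v(2) all by (rule scott_closed_univ)
    show "v \<Turnstile> sharp \<^bold>\<subseteq> cls C"
      unfolding included_def by (rule forces_all_impI[OF goodc_sharp goodc_cls[OF v(2)] all])
    show "v \<Turnstile> \<^bold>\<forall>\<^sub>2C'. scott_closed (cls C') \<^bold>\<longrightarrow> sharp \<^bold>\<subseteq> cls C' \<^bold>\<longrightarrow> cls C \<^bold>\<subseteq> cls C'"
    proof (rule forces_all2I)
      show "goodc2 v (\<lambda>C'. scott_closed (cls C') \<^bold>\<longrightarrow> sharp \<^bold>\<subseteq> cls C' \<^bold>\<longrightarrow> cls C \<^bold>\<subseteq> cls C')"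
        by (rule goodc2I) (insert v(2), (assumption | rule param | erule param_step)+)
      fix u C' assume u: "v \<preceq> u" "C' \<in> subsets u"
      note C = subsets_mono[OF u(1) v(2)]
      show "u \<Turnstile> scott_closed (cls C') \<^bold>\<longrightarrow> sharp \<^bold>\<subseteq> cls C' \<^bold>\<longrightarrow> cls C \<^bold>\<subseteq> cls C'"
      \<comment> \<open>The first two goals of \<open>forces_impI\<close> are goodness of the two
        sides; the third carries the content.\<close>
      proof (rule forces_impI, goal_cases)
        case (3 u1)
        have C1: "C \<in> subsets u1" "C' \<in> subsets u1" using 3 C u by (auto intro: subsets_mono)
        show ?case
        proof (rule forces_impI, goal_cases)
          case (3 u2)
          have wu2: "w \<preceq> u2" and C2: "C \<in> subsets u2" "C' \<in> subsets u2"
            using \<open>u \<preceq> u1\<close> 3 v u C1 by (blast intro: extends_trans subsets_mono)+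
          show ?case
            unfolding included_def
          proof (rule forces_all_impI[OF goodc_cls[OF C2(1)] goodc_cls[OF C2(2)]])
            fix t x assume t: "u2 \<preceq> t" "x \<in> elems t"
            have wt: "w \<preceq> t" "u1 \<preceq> t" using 3 wu2 t by (blast intro: extends_trans)+
            note C' = subsets_mono[OF t(1) C2(2)] and A = goodc_mono[OF wt(1) assms(3)]
            have sub: "t \<Turnstile> sharp \<^bold>\<subseteq> cls C'" using forces_mono[OF t(1)] 3 by blast
            \<comment> \<open>A closed set that contains the sharp elements contains the basis,
              hence every element by \<open>basis_dense\<close>.\<close>
            have "t \<Turnstile> \<^bold>\<forall>a. A a \<^bold>\<longrightarrow> a \<^bold>\<in> C'"
            proof (rule forces_all_impI[OF A goodc_cls[OF C']])
              fix s a assume s: "t \<preceq> s" "a \<in> elems s" "s \<Turnstile> A a"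
              have "s \<Turnstile> sharp a"
                by (rule forces_all_impD[OF forces_mono[OF extends_trans[OF wt(1) s(1)] sharp] s(3)
                      goodc_mono[OF s(1) A] goodc_sharp s(2)])
              then show "s \<Turnstile> a \<^bold>\<in> C'"
                by (rule forces_all_impD[OF forces_mono[OF s(1) sub, unfolded included_def] _ goodc_sharp
                      goodc_cls[OF subsets_mono[OF s(1) C']] s(2)])
            qed
            then show "t \<Turnstile> x \<^bold>\<in> C'"
              using forces_mono[OF wt(1) assms(2)] A forces_mono[OF wt(2)] \<open>u1 \<Turnstile> scott_closed (cls C')\<close> C' t(2)
              by (blast intro: basis_dense)
          qed
        qed (intro good_intros goodc_intros C1)+
      qed (intro good_intros goodc_intros C u)+
    qed
  qed
  then show "v \<Turnstile> \<^bold>\<exists>\<^sub>2C. is_scott_closure (cls C) sharp \<^bold>\<and> (\<^bold>\<forall>x. x \<^bold>\<in> C)"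
    by (intro forces_ex2I[OF _ good v(2)])
      (auto simp: forces_conj intro!: forces_allI goodc_cls v(2) all)
qed

section \<open>Decidability from sharpness\<close>

text \<open>Sharpness of \<open>p\<close> is applied to \<open>c \<lless> c\<close>. Either
  \<open>c \<lless> p\<close>, so \<open>c \<sqsubseteq> p\<close> and then \<open>c = p\<close> as
  \<open>p\<close> is least, or \<open>c \<sqsubseteq> p\<close> is refuted and with it
  \<open>c = p\<close>.\<close>

lemma sharp_bottom_imp_decidable:
  assumes "w \<Turnstile> poset" "w \<Turnstile> is_bottom p" "w \<Turnstile> sharp p" "p \<in> elems w"
  shows "w \<Turnstile> \<^bold>\<forall>c. compact c \<^bold>\<longrightarrow> decidable (c \<^bold>= p)"
proof (rule forces_all_impI[OF goodc_compact goodc_decidable(3)[OF assms(4)]])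
  fix v c assume v: "w \<preceq> v" "c \<in> elems v" "v \<Turnstile> compact c"
  note up = assms(1-3)[THEN forces_mono[OF v(1)]] elems_mono[OF v(1) assms(4)]
  show "v \<Turnstile> decidable (c \<^bold>= p)"
    using sharpD[OF up(3) v(3)[unfolded forces_compact] up(4) v(2,2)]
  proof (rule forces_disjE)
    show "good v (decidable (c \<^bold>= p))" by (intro good_intros v up)
    fix u assume u: "v \<preceq> u"
    note el = elems_mono[OF u v(2)] elems_mono[OF u up(4)] and po = forces_mono[OF u up(1)]
    show "u \<Turnstile> decidable (c \<^bold>= p)" if "u \<Turnstile> c \<^bold>\<lless> p"
      unfolding decidable_def
      by (intro forces_disjI1 poset_antisym[OF po] way_below_imp_le[OF po that] bottom_le[OF po]
          forces_mono[OF u up(2)] good_intros el)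
    assume n: "u \<Turnstile> \<^bold>\<not> (c \<^bold>\<sqsubseteq> p)"
    have "u \<Turnstile> \<^bold>\<not> (c \<^bold>= p)"
    proof (rule forces_notI)
      fix t assume t: "u \<preceq> t" "t \<Turnstile> c \<^bold>= p"
      show "t \<Turnstile> falsity"
        using forces_mono[OF t(1) n] eq_imp_le[OF forces_mono[OF t(1) po] t(2)]
          el[THEN elems_mono[OF t(1)]] by (blast intro: forces_notE good_falsity)
    qed (intro good_intros el)
    then show "u \<Turnstile> decidable (c \<^bold>= p)"
      unfolding decidable_def by (rule forces_disjI2) (intro good_intros el)
  qed
qed

text \<open>Sharpness of \<open>b\<close> at \<open>a \<lless> a\<close> gives
  \<open>a \<lless> b\<close> or a refutation of \<open>a \<sqsubseteq> b\<close>, and the latter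
  refutes \<open>a \<lless> b\<close>.\<close>

lemma sharp_imp_decidable:
  assumes "w \<Turnstile> poset" "w \<Turnstile> \<^bold>\<forall>c. compact c \<^bold>\<longrightarrow> sharp c"
  shows "w \<Turnstile> \<^bold>\<forall>a. \<^bold>\<forall>b. compact a \<^bold>\<longrightarrow> compact b \<^bold>\<longrightarrow> decidable (a \<^bold>\<lless> b)"
proof (rule forces_all_all_impI[OF goodc_compact goodc_decidable_way_below[OF goodc_compact] goodc_decidable(1)])
  fix v a b assume v: "w \<preceq> v" "a \<in> elems v" "b \<in> elems v" "v \<Turnstile> compact a" "v \<Turnstile> compact b"
  have "v \<Turnstile> sharp b"
    by (rule forces_all_impD[OF forces_mono[OF v(1) assms(2)] v(5) goodc_compact goodc_sharp v(3)])
  from sharpD[OF this v(4)[unfolded forces_compact] v(3,2,2)]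
  show "v \<Turnstile> decidable (a \<^bold>\<lless> b)"
  proof (rule forces_disjE)
    show "good v (decidable (a \<^bold>\<lless> b))" by (intro good_intros v)
    fix u assume u: "v \<preceq> u"
    note el = v(2,3)[THEN elems_mono[OF u]]
    show "u \<Turnstile> decidable (a \<^bold>\<lless> b)" if "u \<Turnstile> a \<^bold>\<lless> b"
      unfolding decidable_def using that by (rule forces_disjI1) (intro good_intros el)
    assume n: "u \<Turnstile> \<^bold>\<not> (a \<^bold>\<sqsubseteq> b)"
    have "u \<Turnstile> \<^bold>\<not> (a \<^bold>\<lless> b)"
    proof (rule forces_notI)
      fix t assume t: "u \<preceq> t" "t \<Turnstile> a \<^bold>\<lless> b"
      show "t \<Turnstile> falsity"
        using forces_mono[OF t(1) n] way_below_imp_le[OF forces_mono[OF extends_trans[OF v(1) extends_trans[OF u t(1)]] assms(1)] t(2)]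
          el[THEN elems_mono[OF t(1)]] by (blast intro: forces_notE good_falsity)
    qed (intro good_intros el)
    then show "u \<Turnstile> decidable (a \<^bold>\<lless> b)"
      unfolding decidable_def by (rule forces_disjI2) (intro good_intros el)
  qed
qed

section \<open>The clauses of the theorem and their combination\<close>

text \<open>Pointedness appears as a premise on a variable \<open>p\<close>: the claim is made for
  every least element.\<close>

lemma bottom_part:
  assumes "w \<Turnstile> poset" "w \<Turnstile> basis A" "goodc w A"
  shows "w \<Turnstile> \<^bold>\<forall>p. is_bottom p \<^bold>\<longrightarrow> (\<^bold>\<forall>b. A b \<^bold>\<longrightarrow> decidable (b \<^bold>= p)) \<^bold>\<longrightarrow> sharp p"
proof (rule forces_all_impI)
  show bot: "goodc w is_bottom" by (rule goodcI) (assumption | rule param | erule param_step)+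
  show "goodc w (\<lambda>p. (\<^bold>\<forall>b. A b \<^bold>\<longrightarrow> decidable (b \<^bold>= p)) \<^bold>\<longrightarrow> sharp p)"
    by (rule goodcI, drule goodcD[OF assms(3)]) (assumption | rule param | erule param_step)+
  fix v p assume v: "w \<preceq> v" "p \<in> elems v" "v \<Turnstile> is_bottom p"
  show "v \<Turnstile> (\<^bold>\<forall>b. A b \<^bold>\<longrightarrow> decidable (b \<^bold>= p)) \<^bold>\<longrightarrow> sharp p"
  proof (rule forces_impI)
    show "good v (\<^bold>\<forall>b. A b \<^bold>\<longrightarrow> decidable (b \<^bold>= p))"
      by (intro good_all goodc_imp goodc_decidable goodc_mono[OF v(1) assms(3)] v)
    show "good v (sharp p)" by (intro good_intros v)
    fix u assume u: "v \<preceq> u" "u \<Turnstile> \<^bold>\<forall>b. A b \<^bold>\<longrightarrow> decidable (b \<^bold>= p)"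
    have wu: "w \<preceq> u" using v u by (blast intro: extends_trans)
    show "u \<Turnstile> sharp p"
      by (rule bottom_sharp[OF forces_mono[OF wu assms(1)] forces_mono[OF wu assms(2)]
            goodc_mono[OF wu assms(3)] elems_mono[OF u(1) v(2)] forces_mono[OF u(1) v(3)] u(2)])
  qed
qed

lemma dense_part:
  assumes "w \<Turnstile> poset" "w \<Turnstile> basis A" "goodc w A" and sharp: "w \<Turnstile> \<^bold>\<forall>a. A a \<^bold>\<longrightarrow> sharp a"
  shows "w \<Turnstile> \<^bold>\<forall>\<^sub>2U. scott_open (cls U) \<^bold>\<longrightarrow> inhabited (cls U) \<^bold>\<longrightarrow> (\<^bold>\<exists>x. x \<^bold>\<in> U \<^bold>\<and> sharp x)"
proof (rule forces_all2I)
  show "goodc2 w (\<lambda>U. scott_open (cls U) \<^bold>\<longrightarrow> inhabited (cls U) \<^bold>\<longrightarrow> (\<^bold>\<exists>x. x \<^bold>\<in> U \<^bold>\<and> sharp x))"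
    by (rule goodc2I) (assumption | rule param | erule param_step)+
  fix v U assume v: "w \<preceq> v" "U \<in> subsets v"
  show "v \<Turnstile> scott_open (cls U) \<^bold>\<longrightarrow> inhabited (cls U) \<^bold>\<longrightarrow> (\<^bold>\<exists>x. x \<^bold>\<in> U \<^bold>\<and> sharp x)"
  proof (rule forces_impI, goal_cases)
    case (3 u)
    note U = subsets_mono[OF 3(1) v(2)]
    show ?case
    proof (rule forces_impI, goal_cases)
      case (3 t)
      have wt: "w \<preceq> t" using v 3 \<open>v \<preceq> u\<close> by (blast intro: extends_trans)
      show ?case
        by (rule basis_meets_open[OF forces_mono[OF wt assms(2)] goodc_mono[OF wt assms(3)]
              forces_mono[OF 3(1) \<open>u \<Turnstile> scott_open (cls U)\<close>] subsets_mono[OF 3(1) U] 3(2)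
              forces_mono[OF wt sharp]])
    qed (intro good_intros goodc_intros U)+
  qed (intro good_intros goodc_intros v)+
qed

lemma algebraic_bottom_part:
  assumes "w \<Turnstile> poset" "w \<Turnstile> algebraic"
  shows "w \<Turnstile> \<^bold>\<forall>p. is_bottom p \<^bold>\<longrightarrow>
    (sharp p \<^bold>\<longleftrightarrow> (\<^bold>\<forall>c. compact c \<^bold>\<longrightarrow> decidable (c \<^bold>= p)))"
proof (rule forces_all_impI)
  show bot: "goodc w is_bottom" by (rule goodcI) (assumption | rule param | erule param_step)+
  show "goodc w (\<lambda>p. sharp p \<^bold>\<longleftrightarrow> (\<^bold>\<forall>c. compact c \<^bold>\<longrightarrow> decidable (c \<^bold>= p)))"
    by (rule goodcI) (assumption | rule param | erule param_step)+
  fix v p assume v: "w \<preceq> v" "p \<in> elems v" "v \<Turnstile> is_bottom p"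
  have good: "good v (\<^bold>\<forall>c. compact c \<^bold>\<longrightarrow> decidable (c \<^bold>= p))" "good v (sharp p)"
    by (intro good_all good_sharp goodc_imp goodc_decidable goodc_compact v)+
  show "v \<Turnstile> sharp p \<^bold>\<longleftrightarrow> (\<^bold>\<forall>c. compact c \<^bold>\<longrightarrow> decidable (c \<^bold>= p))"
    unfolding forces_conj
  proof (intro conjI forces_impI good)
    fix u assume u: "v \<preceq> u"
    note po = forces_mono[OF extends_trans[OF v(1) u] assms(1)]
      and alg = forces_mono[OF extends_trans[OF v(1) u] assms(2)]
    show "u \<Turnstile> \<^bold>\<forall>c. compact c \<^bold>\<longrightarrow> decidable (c \<^bold>= p)" if "u \<Turnstile> sharp p"
      by (rule sharp_bottom_imp_decidable[OF po forces_mono[OF u v(3)] that elems_mono[OF u v(2)]])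
    \<comment> \<open>The compact elements serve as the basis in
      \<open>bottom_sharp\<close>.\<close>
    show "u \<Turnstile> sharp p" if "u \<Turnstile> \<^bold>\<forall>c. compact c \<^bold>\<longrightarrow> decidable (c \<^bold>= p)"
      by (rule bottom_sharp[OF po algebraic_imp_basis[OF po alg] goodc_compact elems_mono[OF u v(2)]
            forces_mono[OF u v(3)] that])
  qed
qed

theorem theorem5p14:
  shows "\<turnstile> \<^bold>\<forall>\<^sub>2B. dcpo \<^bold>\<and> continuous \<^bold>\<and> basis (cls B) \<^bold>\<longrightarrow>
    (\<^bold>\<forall>p. is_bottom p \<^bold>\<longrightarrow> (\<^bold>\<forall>b. b \<^bold>\<in> B \<^bold>\<longrightarrow> decidable (b \<^bold>= p)) \<^bold>\<longrightarrow> sharp p)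
  \<^bold>\<and> ((\<^bold>\<forall>a. \<^bold>\<forall>b. a \<^bold>\<in> B \<^bold>\<longrightarrow> b \<^bold>\<in> B \<^bold>\<longrightarrow> decidable (a \<^bold>\<lless> b))
      \<^bold>\<or> (\<^bold>\<forall>a. \<^bold>\<forall>b. a \<^bold>\<in> B \<^bold>\<longrightarrow> b \<^bold>\<in> B \<^bold>\<longrightarrow> decidable (a \<^bold>\<sqsubseteq> b)) \<^bold>\<longrightarrow>
        (\<^bold>\<forall>b. b \<^bold>\<in> B \<^bold>\<longrightarrow> sharp b)
      \<^bold>\<and> (\<^bold>\<exists>\<^sub>2C. is_scott_closure (cls C) sharp \<^bold>\<and> (\<^bold>\<forall>x. x \<^bold>\<in> C))
      \<^bold>\<and> (\<^bold>\<forall>\<^sub>2U. scott_open (cls U) \<^bold>\<longrightarrow> inhabited (cls U) \<^bold>\<longrightarrow> (\<^bold>\<exists>x. x \<^bold>\<in> U \<^bold>\<and> sharp x)))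
  \<^bold>\<and> (algebraic \<^bold>\<longrightarrow>
        (\<^bold>\<forall>p. is_bottom p \<^bold>\<longrightarrow>
          (sharp p \<^bold>\<longleftrightarrow> (\<^bold>\<forall>c. compact c \<^bold>\<longrightarrow> decidable (c \<^bold>= p))))
      \<^bold>\<and> ((\<^bold>\<forall>c. compact c \<^bold>\<longrightarrow> sharp c) \<^bold>\<longleftrightarrow>
          (\<^bold>\<forall>a. \<^bold>\<forall>b. compact a \<^bold>\<longrightarrow> compact b \<^bold>\<longrightarrow> decidable (a \<^bold>\<lless> b))
          \<^bold>\<or> (\<^bold>\<forall>a. \<^bold>\<forall>b. compact a \<^bold>\<longrightarrow> compact b \<^bold>\<longrightarrow> decidable (a \<^bold>\<sqsubseteq> b))))"
\<comment> \<open>The statement is shown to be forced at every world; at the one with no variables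
  and no hypotheses this gives derivability.\<close>
proof (rule provableI, rule forces_all2I)
  fix w :: world
  show "goodc2 w (\<lambda>B. dcpo \<^bold>\<and> continuous \<^bold>\<and> basis (cls B) \<^bold>\<longrightarrow>
    (\<^bold>\<forall>p. is_bottom p \<^bold>\<longrightarrow> (\<^bold>\<forall>b. b \<^bold>\<in> B \<^bold>\<longrightarrow> decidable (b \<^bold>= p)) \<^bold>\<longrightarrow> sharp p)
  \<^bold>\<and> ((\<^bold>\<forall>a. \<^bold>\<forall>b. a \<^bold>\<in> B \<^bold>\<longrightarrow> b \<^bold>\<in> B \<^bold>\<longrightarrow> decidable (a \<^bold>\<lless> b))
      \<^bold>\<or> (\<^bold>\<forall>a. \<^bold>\<forall>b. a \<^bold>\<in> B \<^bold>\<longrightarrow> b \<^bold>\<in> B \<^bold>\<longrightarrow> decidable (a \<^bold>\<sqsubseteq> b)) \<^bold>\<longrightarrow>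
        (\<^bold>\<forall>b. b \<^bold>\<in> B \<^bold>\<longrightarrow> sharp b)
      \<^bold>\<and> (\<^bold>\<exists>\<^sub>2C. is_scott_closure (cls C) sharp \<^bold>\<and> (\<^bold>\<forall>x. x \<^bold>\<in> C))
      \<^bold>\<and> (\<^bold>\<forall>\<^sub>2U. scott_open (cls U) \<^bold>\<longrightarrow> inhabited (cls U) \<^bold>\<longrightarrow> (\<^bold>\<exists>x. x \<^bold>\<in> U \<^bold>\<and> sharp x)))
  \<^bold>\<and> (algebraic \<^bold>\<longrightarrow>
        (\<^bold>\<forall>p. is_bottom p \<^bold>\<longrightarrow>
          (sharp p \<^bold>\<longleftrightarrow> (\<^bold>\<forall>c. compact c \<^bold>\<longrightarrow> decidable (c \<^bold>= p))))
      \<^bold>\<and> ((\<^bold>\<forall>c. compact c \<^bold>\<longrightarrow> sharp c) \<^bold>\<longleftrightarrow>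
          (\<^bold>\<forall>a. \<^bold>\<forall>b. compact a \<^bold>\<longrightarrow> compact b \<^bold>\<longrightarrow> decidable (a \<^bold>\<lless> b))
          \<^bold>\<or> (\<^bold>\<forall>a. \<^bold>\<forall>b. compact a \<^bold>\<longrightarrow> compact b \<^bold>\<longrightarrow> decidable (a \<^bold>\<sqsubseteq> b)))))"
    (is "goodc2 w (\<lambda>B. ?hyp B \<^bold>\<longrightarrow> ?i B \<^bold>\<and> (?dec (cls B) \<^bold>\<longrightarrow> ?ii B) \<^bold>\<and> (algebraic \<^bold>\<longrightarrow> ?iii \<^bold>\<and> ?iv))")
    by (rule goodc2I) (assumption | rule param | erule param_step)+
  fix v B assume B: "B \<in> subsets v"
  have good: "good v (?hyp B)" "good v (?i B \<^bold>\<and> (?dec (cls B) \<^bold>\<longrightarrow> ?ii B) \<^bold>\<and> (algebraic \<^bold>\<longrightarrow> ?iii \<^bold>\<and> ?iv))"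
    "good v (?dec (cls B))" "good v (?ii B)" "good v (?iii \<^bold>\<and> ?iv)" "good v (?dec compact)"
    "good v (\<^bold>\<forall>c. compact c \<^bold>\<longrightarrow> sharp c)"
    by ((rule goodI, insert B, (assumption | rule param | erule param_step)+)+)
  show "v \<Turnstile> ?hyp B \<^bold>\<longrightarrow> ?i B \<^bold>\<and> (?dec (cls B) \<^bold>\<longrightarrow> ?ii B) \<^bold>\<and> (algebraic \<^bold>\<longrightarrow> ?iii \<^bold>\<and> ?iv)"
  proof (rule forces_impI[OF good(1,2)])
    fix u assume u: "v \<preceq> u" "u \<Turnstile> ?hyp B"
    have po: "u \<Turnstile> poset" and ba: "u \<Turnstile> basis (cls B)"
      using u(2) unfolding dcpo_def forces_conj by blast+
    note B = goodc_cls[OF subsets_mono[OF u(1) B]]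
    have ii: "u \<Turnstile> ?dec (cls B) \<^bold>\<longrightarrow> ?ii B"
    proof (rule forces_impI[OF good(3,4)[THEN good_mono[OF u(1)]]])
      fix t assume t: "u \<preceq> t" "t \<Turnstile> ?dec (cls B)"
      note facts = forces_mono[OF t(1) po] forces_mono[OF t(1) ba] goodc_mono[OF t(1) B]
      \<comment> \<open>Once the basis elements are sharp, both forms of density follow from this
        alone together with the basis property.\<close>
      note sharp = decidable_imp_sharp[OF facts t(2)]
      show "t \<Turnstile> ?ii B"
        unfolding forces_conj using sharp sharp_closure[OF facts sharp] dense_part[OF facts sharp] by blast
    qed
    have "u \<Turnstile> algebraic \<^bold>\<longrightarrow> ?iii \<^bold>\<and> ?iv"
    proof (rule forces_impI[OF good_algebraic good_mono[OF u(1) good(5)]])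
      fix t assume t: "u \<preceq> t" "t \<Turnstile> algebraic"
      note po_t = forces_mono[OF t(1) po]
      note good' = good(6,7)[THEN good_mono[OF extends_trans[OF u(1) t(1)]]]
      have "t \<Turnstile> ?iv"
        unfolding forces_conj
      proof (intro conjI forces_impI good')
        fix s assume s: "t \<preceq> s"
        note po_s = forces_mono[OF s po_t]
        show "s \<Turnstile> \<^bold>\<forall>c. compact c \<^bold>\<longrightarrow> sharp c" if "s \<Turnstile> ?dec compact"
          by (rule decidable_imp_sharp[OF po_s algebraic_imp_basis[OF po_s forces_mono[OF s t(2)]]
                goodc_compact that])
        \<comment> \<open>The disjunction is derived by naming a side: sharpness of the compact
          elements yields decidability of \<open>\<lless>\<close>, the first alternative.\<close>
        show "s \<Turnstile> ?dec compact" if "s \<Turnstile> \<^bold>\<forall>c. compact c \<^bold>\<longrightarrow> sharp c"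
          by (rule forces_disjI1[OF sharp_imp_decidable[OF po_s that]])
            (intro good_all goodc_decidable_le goodc_compact)
      qed
      then show "t \<Turnstile> ?iii \<^bold>\<and> ?iv"
        using algebraic_bottom_part[OF po_t t(2)] by (simp only: forces_conj)
    qed
    then show "u \<Turnstile> ?i B \<^bold>\<and> (?dec (cls B) \<^bold>\<longrightarrow> ?ii B) \<^bold>\<and> (algebraic \<^bold>\<longrightarrow> ?iii \<^bold>\<and> ?iv)"
      using ii bottom_part[OF po ba B] by (simp only: forces_conj)
  qed
qed

end
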